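(* Let $M$ be a nonempty smooth manifold of positive dimension and let $(M,J,g)$ be an $(\alpha,\varepsilon)$-metric manifold with $\alpha=-1$. Then the generalized almost paracomplex structure $$\mathcal F_{J,g}=\begin{pmatrix}J&\sqrt2\,\sharp_g\\ \sqrt2\,\flat_g&\varepsilon J^*\end{pmatrix}$$ on $\mathbb TM=TM\oplus T^*M$ is compatible with the natural generalized metric $\mathcal G_0$ if and only if $\varepsilon=+1$, that is, if and only if $(M,J,g)$ is an almost Hermitian or indefinite almost Hermitian manifold (depending on $g$). In this case, $(\mathcal F_{J,g},\mathcal G_0)$ is a generalized pseudo-Riemannian almost product structure, with twin metric $$\Phi_{\mathcal F_{J,g}}(X+\xi,Y+\eta)=\mathcal G_0(JX+\xi,JY+\eta)+\tfrac{\sqrt2}{2}\big(g(X,Y)+g(\sharp_g\xi,\sharp_g\eta)\big)$$ for all $X,Y\in\mathfrak X(M)$, $\xi,\eta\in\Lambda^1(M)$.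
   Context: An $(\alpha,\varepsilon)$-metric manifold $(M,J,g)$, $\alpha,\varepsilon\in\{+1,-1\}$, is a smooth manifold with a Riemannian or pseudo-Riemannian (i.e. nondegenerate, not positive definite) metric $g$ and an $\mathfrak F(M)$-linear $J\colon\mathfrak X(M)\to\mathfrak X(M)$ with $J^2=\alpha Id$ and $g(JX,JY)=\varepsilon g(X,Y)$ for all $X,Y$. For $\alpha=-1,\varepsilon=+1$ it is called almost Hermitian (resp. indefinite almost Hermitian) if $g$ is Riemannian (resp. pseudo-Riemannian). $\mathfrak F(M)$, $\mathfrak X(M)$, $\Lambda^1(M)$ denote smooth functions, vector fields, 1-forms; sections of $\mathbb TM$ are written $X+\xi$. $(\flat_gX)(Y)=g(X,Y)$, $\sharp_g=\flat_g^{-1}$, $(J^*\xi)(X)=\xi(JX)$. Matrix notation: $\begin{pmatrix}H&\sigma\\ \tau&K\end{pmatrix}(X+\xi)=(HX+\sigma\xi)+(\tau X+K\xi)$. A generalized almost paracomplex structure is an $\mathfrak F(M)$-linear endomorphism $\mathcal F$ of $\Gamma(\mathbb TM)$ with $\mathcal F^2=Id$ whose $\pm1$-eigenbundles have equal rank. $\mathcal G_0(X+\xi,Y+\eta)=\frac12(\xi(Y)+\eta(X))$. An endomorphism $\mathcal K$ is compatible with a metric $\mathcal G$ on $\mathbb TM$ if there is $\delta\in\{+1,-1\}$ with $\mathcal G(\mathcal Ku,\mathcal Kv)=\delta\,\mathcal G(u,v)$ for all sections $u,v$. $(\mathcal F,\mathcal G)$ with $\mathcal F^2=Id$ and $\mathcal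 G$ not positive definite is generalized pseudo-Riemannian almost product if $\mathcal G(\mathcal Fu,\mathcal Fv)=\mathcal G(u,v)$ for all $u,v$; its twin metric is $\Phi_{\mathcal F}(u,v)=\mathcal G(\mathcal Fu,v)$. *)

theory Defs
  imports "HOL-Analysis.Analysis" "HOL-Library.Function_Algebras"
begin

text \<open>
  Functions carry the pointwise \<open>0\<close>, \<open>+\<close> and \<open>*\<close> of \<^theory>\<open>HOL-Library.Function_Algebras\<close>.
\<close>


subsection \<open>Smooth manifolds\<close>

text \<open>Only meaningful for open \<open>S\<close>.\<close>

primrec Ck_on :: "nat \<Rightarrow> 'e::euclidean_space set \<Rightarrow> ('e \<Rightarrow> 'f::real_normed_vector) \<Rightarrow> bool" where
  "Ck_on 0 S f \<longleftrightarrow> continuous_on S f"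
| "Ck_on (Suc k) S f \<longleftrightarrow>
     (\<forall>x\<in>S. f differentiable (at x)) \<and> (\<forall>v. Ck_on k S (\<lambda>x. frechet_derivative f (at x) v))"

definition smooth_on :: "'e::euclidean_space set \<Rightarrow> ('e \<Rightarrow> 'f::real_normed_vector) \<Rightarrow> bool" where
  "smooth_on S f \<longleftrightarrow> (\<forall>k. Ck_on k S f)"

text \<open>
  A chart is a pair \<open>(U, \<phi>)\<close>. The manifold is the whole type \<open>'a\<close>, hence nonempty; Hausdorffness and
  second countability are type class constraints. The dimension is \<open>DIM('e)\<close>, which is positive for
  every Euclidean space type. Any atlas determines the smooth structure, so maximality is not
  required.
\<close>

type_synonym ('a, 'e) atlas = "('a set \<times> ('a \<Rightarrow> 'e)) set"

definition smooth_manifold ::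
    "('a::{t2_space, second_countable_topology}, 'e::euclidean_space) atlas \<Rightarrow> bool" where
  "smooth_manifold A \<longleftrightarrow>
     (\<forall>(U, \<phi>)\<in>A. open U \<and> open (\<phi> ` U) \<and> homeomorphism U (\<phi> ` U) \<phi> (inv_into U \<phi>)) \<and>
     (\<Union>(U, \<phi>)\<in>A. U) = UNIV \<and>
     (\<forall>(U, \<phi>)\<in>A. \<forall>(V, \<psi>)\<in>A. smooth_on (\<phi> ` (U \<inter> V)) (\<psi> \<circ> inv_into U \<phi>))"

definition smooth_functions :: "('a, 'e::euclidean_space) atlas \<Rightarrow> ('a \<Rightarrow> real) set" where
  "smooth_functions A = {f. \<forall>(U, \<phi>)\<in>A. smooth_on (\<phi> ` U) (f \<circ> inv_into U \<phi>)}"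


subsection \<open>Vector fields and 1-forms\<close>

text \<open>
  Vector fields are the derivations of the algebra of smooth functions and 1-forms are the
  function-linear maps from vector fields to smooth functions. Both are extended by \<open>0\<close> outside
  their domain, so that HOL equality is equality of fields and of forms.
\<close>

type_synonym 'a vfield = "('a \<Rightarrow> real) \<Rightarrow> 'a \<Rightarrow> real"
type_synonym 'a form1 = "'a vfield \<Rightarrow> 'a \<Rightarrow> real"

definition vector_fields :: "('a, 'e::euclidean_space) atlas \<Rightarrow> 'a vfield set" where
  "vector_fields A = {X.
     (\<forall>f. f \<notin> smooth_functions A \<longrightarrow> X f = 0) \<and>
     (\<forall>f\<in>smooth_functions A. X f \<in> smooth_functions A) \<and>
     (\<forall>f\<in>smooth_functions A. \<forall>h\<in>smooth_functions A. X (f + h) = X f + X h) \<and>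
     (\<forall>c. \<forall>f\<in>smooth_functions A. X (\<lambda>p. c * f p) = (\<lambda>p. c * X f p)) \<and>
     (\<forall>f\<in>smooth_functions A. \<forall>h\<in>smooth_functions A. X (f * h) = X f * h + f * X h)}"

text \<open>
  Multiplication of a vector field or 1-form by a function; real scalars enter as constant functions.
\<close>

definition fscale :: "('a \<Rightarrow> real) \<Rightarrow> ('x \<Rightarrow> 'a \<Rightarrow> real) \<Rightarrow> 'x \<Rightarrow> 'a \<Rightarrow> real" where
  "fscale f X = (\<lambda>x. f * X x)"

text \<open>
  \<open>L\<close> is linear over the smooth functions from the module \<open>S\<close>, with scalar multiplication \<open>s\<close>,
  to the module \<open>T\<close>, with scalar multiplication \<open>t\<close>.
\<close>

definition function_linear ::
    "('a, 'e::euclidean_space) atlas \<Rightarrow>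
     (('a \<Rightarrow> real) \<Rightarrow> 'm::plus \<Rightarrow> 'm) \<Rightarrow> 'm set \<Rightarrow> (('a \<Rightarrow> real) \<Rightarrow> 'n::plus \<Rightarrow> 'n) \<Rightarrow> 'n set \<Rightarrow>
     ('m \<Rightarrow> 'n) \<Rightarrow> bool" where
  "function_linear A s S t T L \<longleftrightarrow>
     (\<forall>u\<in>S. L u \<in> T) \<and>
     (\<forall>u\<in>S. \<forall>v\<in>S. L (u + v) = L u + L v) \<and>
     (\<forall>f\<in>smooth_functions A. \<forall>u\<in>S. L (s f u) = t f (L u))"

definition one_forms :: "('a, 'e::euclidean_space) atlas \<Rightarrow> 'a form1 set" where
  "one_forms A = {\<xi>.
     (\<forall>X. X \<notin> vector_fields A \<longrightarrow> \<xi> X = 0) \<and>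
     function_linear A fscale (vector_fields A) (*) (smooth_functions A) \<xi>}"

text \<open>
  The value at the point \<open>p\<close>: for a vector field the tangent vector \<open>f \<mapsto> (X f)(p)\<close>, for a 1-form the
  covector, viewed as the map \<open>Y \<mapsto> (\<xi>(Y))(p)\<close> on vector fields.
\<close>

definition value_at :: "'a \<Rightarrow> ('x \<Rightarrow> 'a \<Rightarrow> real) \<Rightarrow> 'x \<Rightarrow> real" where
  "value_at p X = (\<lambda>x. X x p)"


subsection \<open>Sections of the generalized tangent bundle\<close>

text \<open>The section \<open>X + \<xi>\<close> is the pair \<open>(X, \<xi>)\<close>.\<close>

type_synonym 'a gsection = "'a vfield \<times> 'a form1"

definition gsections :: "('a, 'e::euclidean_space) atlas \<Rightarrow> 'a gsection set" where
  "gsections A = vector_fields A \<times> one_forms A"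

definition gscale :: "('a \<Rightarrow> real) \<Rightarrow> 'a gsection \<Rightarrow> 'a gsection" where
  "gscale f u = (fscale f (fst u), fscale f (snd u))"

type_synonym 'a gvector = "(('a \<Rightarrow> real) \<Rightarrow> real) \<times> ('a vfield \<Rightarrow> real)"

definition gvalue_at :: "'a \<Rightarrow> 'a gsection \<Rightarrow> 'a gvector" where
  "gvalue_at p u = (value_at p (fst u), value_at p (snd u))"

definition gvector_scale :: "real \<Rightarrow> 'a gvector \<Rightarrow> 'a gvector" where
  "gvector_scale c w = (\<lambda>f. c * fst w f, \<lambda>Y. c * snd w Y)"

definition gmatrix ::
    "('a vfield \<Rightarrow> 'a vfield) \<Rightarrow> ('a form1 \<Rightarrow> 'a vfield) \<Rightarrow> ('a vfield \<Rightarrow> 'a form1) \<Rightarrow> ('a form1 \<Rightarrow> 'a form1) \<Rightarrow>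
     'a gsection \<Rightarrow> 'a gsection" where
  "gmatrix H \<sigma> \<tau> K u = (H (fst u) + \<sigma> (snd u), \<tau> (fst u) + K (snd u))"


subsection \<open>Metrics\<close>

text \<open>
  Metrics on a vector bundle given by its module of sections \<open>S\<close>, with scalar multiplication \<open>s\<close> and
  evaluation \<open>ev\<close> at points. Nondegeneracy and definiteness are fibrewise; this can be tested on
  sections because every vector of a fibre is the value of a section.
\<close>

definition bundle_metric ::
    "('a, 'e::euclidean_space) atlas \<Rightarrow>
     (('a \<Rightarrow> real) \<Rightarrow> 'm::plus \<Rightarrow> 'm) \<Rightarrow> ('a \<Rightarrow> 'm \<Rightarrow> 'v::zero) \<Rightarrow> 'm set \<Rightarrow> ('m \<Rightarrow> 'm \<Rightarrow> 'a \<Rightarrow> real) \<Rightarrow> bool" where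
  "bundle_metric A s ev S G \<longleftrightarrow>
     (\<forall>u\<in>S. function_linear A s S (*) (smooth_functions A) (G u)) \<and>
     (\<forall>u\<in>S. \<forall>v\<in>S. G u v = G v u) \<and>
     (\<forall>p. \<forall>u\<in>S. (\<forall>v\<in>S. G u v p = 0) \<longrightarrow> ev p u = 0)"

definition positive_definite ::
    "('a \<Rightarrow> 'm \<Rightarrow> 'v::zero) \<Rightarrow> 'm set \<Rightarrow> ('m \<Rightarrow> 'm \<Rightarrow> 'a \<Rightarrow> real) \<Rightarrow> bool" where
  "positive_definite ev S G \<longleftrightarrow> (\<forall>p. \<forall>u\<in>S. ev p u \<noteq> 0 \<longrightarrow> G u u p > 0)"

definition riemannian_metric ::
    "('a, 'e::euclidean_space) atlas \<Rightarrow> ('a vfield \<Rightarrow> 'a vfield \<Rightarrow> 'a \<Rightarrow> real) \<Rightarrow> bool" where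
  "riemannian_metric A g \<longleftrightarrow>
     bundle_metric A fscale value_at (vector_fields A) g \<and>
     positive_definite value_at (vector_fields A) g"

definition pseudo_riemannian_metric ::
    "('a, 'e::euclidean_space) atlas \<Rightarrow> ('a vfield \<Rightarrow> 'a vfield \<Rightarrow> 'a \<Rightarrow> real) \<Rightarrow> bool" where
  "pseudo_riemannian_metric A g \<longleftrightarrow>
     bundle_metric A fscale value_at (vector_fields A) g \<and>
     \<not> positive_definite value_at (vector_fields A) g"

definition flat ::
    "('a, 'e::euclidean_space) atlas \<Rightarrow> ('a vfield \<Rightarrow> 'a vfield \<Rightarrow> 'a \<Rightarrow> real) \<Rightarrow> 'a vfield \<Rightarrow> 'a form1" where
  "flat A g X = (\<lambda>Y. if Y \<in> vector_fields A then g X Y else 0)"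

definition sharp ::
    "('a, 'e::euclidean_space) atlas \<Rightarrow> ('a vfield \<Rightarrow> 'a vfield \<Rightarrow> 'a \<Rightarrow> real) \<Rightarrow> 'a form1 \<Rightarrow> 'a vfield" where
  "sharp A g = inv_into (vector_fields A) (flat A g)"

definition dual_endo ::
    "('a, 'e::euclidean_space) atlas \<Rightarrow> ('a vfield \<Rightarrow> 'a vfield) \<Rightarrow> 'a form1 \<Rightarrow> 'a form1" where
  "dual_endo A J \<xi> = (\<lambda>X. if X \<in> vector_fields A then \<xi> (J X) else 0)"


subsection \<open>Metric manifolds with a structure endomorphism\<close>

definition metric_manifold ::
    "('a::{t2_space, second_countable_topology}, 'e::euclidean_space) atlas \<Rightarrow> real \<Rightarrow> real \<Rightarrow>
     ('a vfield \<Rightarrow> 'a vfield) \<Rightarrow> ('a vfield \<Rightarrow> 'a vfield \<Rightarrow> 'a \<Rightarrow> real) \<Rightarrow> bool" where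
  "metric_manifold A \<alpha> \<epsilon> J g \<longleftrightarrow>
     \<alpha> \<in> {1, -1} \<and> \<epsilon> \<in> {1, -1} \<and>
     smooth_manifold A \<and>
     (riemannian_metric A g \<or> pseudo_riemannian_metric A g) \<and>
     function_linear A fscale (vector_fields A) fscale (vector_fields A) J \<and>
     (\<forall>X\<in>vector_fields A. J (J X) = fscale (\<lambda>_. \<alpha>) X) \<and>
     (\<forall>X\<in>vector_fields A. \<forall>Y\<in>vector_fields A. g (J X) (J Y) = (\<lambda>p. \<epsilon> * g X Y p))"

definition almost_hermitian ::
    "('a::{t2_space, second_countable_topology}, 'e::euclidean_space) atlas \<Rightarrow>
     ('a vfield \<Rightarrow> 'a vfield) \<Rightarrow> ('a vfield \<Rightarrow> 'a vfield \<Rightarrow> 'a \<Rightarrow> real) \<Rightarrow> bool" where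
  "almost_hermitian A J g \<longleftrightarrow> metric_manifold A (-1) 1 J g \<and> riemannian_metric A g"

definition indefinite_almost_hermitian ::
    "('a::{t2_space, second_countable_topology}, 'e::euclidean_space) atlas \<Rightarrow>
     ('a vfield \<Rightarrow> 'a vfield) \<Rightarrow> ('a vfield \<Rightarrow> 'a vfield \<Rightarrow> 'a \<Rightarrow> real) \<Rightarrow> bool" where
  "indefinite_almost_hermitian A J g \<longleftrightarrow> metric_manifold A (-1) 1 J g \<and> pseudo_riemannian_metric A g"


subsection \<open>Generalized structures\<close>

definition eigenbundle_fibre ::
    "('a, 'e::euclidean_space) atlas \<Rightarrow> ('a gsection \<Rightarrow> 'a gsection) \<Rightarrow> real \<Rightarrow> 'a \<Rightarrow> 'a gvector set" where
  "eigenbundle_fibre A F c p = gvalue_at p ` {u \<in> gsections A. F u = gscale (\<lambda>_. c) u}"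

definition gen_almost_paracomplex ::
    "('a, 'e::euclidean_space) atlas \<Rightarrow> ('a gsection \<Rightarrow> 'a gsection) \<Rightarrow> bool" where
  "gen_almost_paracomplex A F \<longleftrightarrow>
     function_linear A gscale (gsections A) gscale (gsections A) F \<and>
     (\<forall>u\<in>gsections A. F (F u) = u) \<and>
     (\<forall>p. vector_space.dim gvector_scale (eigenbundle_fibre A F 1 p) =
          vector_space.dim gvector_scale (eigenbundle_fibre A F (-1) p))"

definition natural_metric :: "'a gsection \<Rightarrow> 'a gsection \<Rightarrow> 'a \<Rightarrow> real" where
  "natural_metric u v = (\<lambda>p. 1 / 2 * (snd u (fst v) p + snd v (fst u) p))"

definition compatible ::
    "('a, 'e::euclidean_space) atlas \<Rightarrow> ('a gsection \<Rightarrow> 'a gsection) \<Rightarrow>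
     ('a gsection \<Rightarrow> 'a gsection \<Rightarrow> 'a \<Rightarrow> real) \<Rightarrow> bool" where
  "compatible A K G \<longleftrightarrow>
     (\<exists>\<delta>\<in>{1, -1}. \<forall>u\<in>gsections A. \<forall>v\<in>gsections A. G (K u) (K v) = (\<lambda>p. \<delta> * G u v p))"

definition gen_pseudo_riemannian_almost_product ::
    "('a, 'e::euclidean_space) atlas \<Rightarrow> ('a gsection \<Rightarrow> 'a gsection) \<Rightarrow>
     ('a gsection \<Rightarrow> 'a gsection \<Rightarrow> 'a \<Rightarrow> real) \<Rightarrow> bool" where
  "gen_pseudo_riemannian_almost_product A F G \<longleftrightarrow>
     function_linear A gscale (gsections A) gscale (gsections A) F \<and>
     (\<forall>u\<in>gsections A. F (F u) = u) \<and>
     bundle_metric A gscale gvalue_at (gsections A) G \<and>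
     \<not> positive_definite gvalue_at (gsections A) G \<and>
     (\<forall>u\<in>gsections A. \<forall>v\<in>gsections A. G (F u) (F v) = G u v)"

definition twin_metric ::
    "('a gsection \<Rightarrow> 'a gsection) \<Rightarrow> ('a gsection \<Rightarrow> 'a gsection \<Rightarrow> 'a \<Rightarrow> real) \<Rightarrow>
     'a gsection \<Rightarrow> 'a gsection \<Rightarrow> 'a \<Rightarrow> real" where
  "twin_metric F G u v = G (F u) v"

definition F_Jg ::
    "('a, 'e::euclidean_space) atlas \<Rightarrow> real \<Rightarrow> ('a vfield \<Rightarrow> 'a vfield) \<Rightarrow>
     ('a vfield \<Rightarrow> 'a vfield \<Rightarrow> 'a \<Rightarrow> real) \<Rightarrow> 'a gsection \<Rightarrow> 'a gsection" where
  "F_Jg A \<epsilon> J g =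
     gmatrix J                                      (\<lambda>\<xi>. fscale (\<lambda>_. sqrt 2) (sharp A g \<xi>))
             (\<lambda>X. fscale (\<lambda>_. sqrt 2) (flat A g X)) (\<lambda>\<xi>. fscale (\<lambda>_. \<epsilon>) (dual_endo A J \<xi>))"

end

theory Submission
  imports Defs "HOL-Real_Asymp.Real_Asymp"
begin

text \<open>
  The metric identifies \<open>T\<^sup>*M\<close> with \<open>TM\<close>. Since \<open>J\<^sup>*\<flat> = -\<epsilon>\<flat>J\<close>, the structure becomes the block
  matrix \<open>F = (J, \<surd>2; \<surd>2, -J)\<close> on \<open>TM \<oplus> TM\<close>, so \<open>F\<^sup>2 = Id\<close> follows from \<open>J\<^sup>2 = -Id\<close>, and \<open>F\<close>
  anticommutes with the rotation \<open>(X, Z) \<mapsto> (Z, -X)\<close>, which therefore exchanges the two eigenbundles.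
  Expanding the natural metric gives
  \<open>G(Fu, Fv) = (2 - \<epsilon>) G(u, v) + (\<surd>2/2) (1 - \<epsilon>) (g(X, JY) + \<epsilon> g(Z, JW))\<close> for \<open>u = X + \<flat>Z\<close>, \<open>v = Y + \<flat>W\<close>;
  for \<open>\<epsilon> = -1\<close> and \<open>Z = W = 0\<close> this would force \<open>g(X, JY) = 0\<close>.

  As vector fields are derivations and 1-forms are function-linear maps, the existence of \<open>\<sharp>\<close> is the
  analytic point. Hadamard's lemma and bump functions provide local coordinate frames; in such a frame
  \<open>\<flat>X = \<xi>\<close> is a linear system with smooth coefficients, nonsingular at the base point, solvable nearby
  by elimination, and the local solutions are unique and hence glue.
\<close>

subsection \<open>Smooth maps between Euclidean spaces\<close>

text \<open>The constant \<surd>2 is chosen against \<open>J\<^sup>2 = -Id\<close>: the diagonal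
  blocks of \<open>F\<^sup>2\<close> are -1 + 2 = 1, and the mixed terms \<surd>2 J and -\<surd>2 J
  cancel. The sign \<epsilon> enters the lower right block twice and drops out, so the algebra of F
  is the same for both signs and only the natural metric sees the difference. Two pure vector fields
  pair to 0, so that case of the expansion refutes compatibility for both values of \<delta> at
  once. The contradiction needs g to be nonzero at some point, and this is where positive dimension
  enters.

  The analytic obstacle is that derivations and function-linear maps act on global objects, so
  nothing can be computed in a chart before locality is established. Local data are therefore cut
  off to global functions and fields that are correct near a given point. The ranks of the two
  eigenbundles are compared without being computed; for this the rotation, defined on sections, has
  to descend to the fibres.\<close>

lemma Ck_on_SucD:
  assumes "Ck_on (Suc k) S f" "x \<in> S"
  shows "(f has_derivative frechet_derivative f (at x)) (at x)"
  using assms by (simp add: frechet_derivative_works)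

text \<open>\<open>Ck_on\<close> differentiates at x in the full space, not within S. Openness of S
  is what makes agreement on S carry over to the derivatives.\<close>

lemma Ck_on_cong:
  assumes "open S" "\<And>x. x \<in> S \<Longrightarrow> f x = h x" "Ck_on k S f"
  shows "Ck_on k S h"
  using assms(2,3)
proof (induction k arbitrary: f h)
  case 0
  then show ?case by (metis Ck_on.simps(1) continuous_on_cong)
next
  case (Suc k)
  have d: "(h has_derivative D) (at x) \<longleftrightarrow> (f has_derivative D) (at x)" if "x \<in> S" for x D
    using has_derivative_transform_within_open[OF _ assms(1) that] Suc.prems(1) by metis
  have fd: "frechet_derivative h (at x) = frechet_derivative f (at x)" if "x \<in> S" for x
    unfolding frechet_derivative_def using d[OF that] by simp
  have "Ck_on k S (\<lambda>x. frechet_derivative h (at x) v)" for v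
    by (rule Suc.IH[of "\<lambda>x. frechet_derivative f (at x) v"]) (use fd Suc.prems(2) in auto)
  then show ?case
    using Suc.prems(2) d unfolding Ck_on.simps differentiable_def by metis
qed

text \<open>Replaces the chosen \<open>frechet_derivative\<close> by an explicit formula that needs
  to be right on S only. The closure properties below all use it.\<close>

lemma Ck_on_SucI:
  assumes "open S" "\<And>x. x \<in> S \<Longrightarrow> (f has_derivative f' x) (at x)" "\<And>v. Ck_on k S (\<lambda>x. f' x v)"
  shows "Ck_on (Suc k) S f"
proof -
  have fd: "frechet_derivative f (at x) = f' x" if "x \<in> S" for x
    using frechet_derivative_at[OF assms(2)[OF that]] by simp
  have "Ck_on k S (\<lambda>x. frechet_derivative f (at x) v)" for v
    by (rule Ck_on_cong[OF assms(1) _ assms(3)]) (simp add: fd)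
  then show ?thesis
    using assms(2) by (auto simp: differentiable_def)
qed

lemma Ck_on_subset: "Ck_on k S f \<Longrightarrow> T \<subseteq> S \<Longrightarrow> Ck_on k T f"
  by (induction k arbitrary: f) (auto intro: continuous_on_subset)

lemma Ck_on_Suc_imp: "Ck_on (Suc k) S f \<Longrightarrow> Ck_on k S f"
proof (induction k arbitrary: f)
  case 0
  then show ?case
    by (auto intro!: continuous_at_imp_continuous_on differentiable_imp_continuous_within)
qed simp

lemma Ck_on_imp_continuous_on: "Ck_on k S f \<Longrightarrow> continuous_on S f"
proof (induction k)
  case (Suc k)
  then show ?case using Ck_on_Suc_imp by blast
qed simp

lemma Ck_on_locally:
  assumes "\<And>x. x \<in> S \<Longrightarrow> \<exists>T. open T \<and> x \<in> T \<and> Ck_on k T f"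
  shows "Ck_on k S f"
  using assms
proof (induction k arbitrary: f)
  case 0
  then have "continuous (at x) f" if "x \<in> S" for x
    using that by (metis Ck_on.simps(1) continuous_on_eq_continuous_at)
  then show ?case by (simp add: continuous_at_imp_continuous_on)
next
  case (Suc k)
  have "Ck_on k S (\<lambda>x. frechet_derivative f (at x) v)" for v
    by (rule Suc.IH) (metis Ck_on.simps(2) Suc.prems)
  moreover have "f differentiable (at x)" if "x \<in> S" for x
    using Suc.prems[OF that] by auto
  ultimately show ?case by simp
qed

lemma Ck_on_const: "open S \<Longrightarrow> Ck_on k S (\<lambda>x. c)"
proof (induction k arbitrary: c)
  case (Suc k)
  show ?case by (rule Ck_on_SucI[where f' = "\<lambda>_ _. 0"]) (use Suc in auto)
qed simp

lemma Ck_on_bounded_linear: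
  assumes "open S" "bounded_linear L" "Ck_on k S f"
  shows "Ck_on k S (\<lambda>x. L (f x))"
  using assms(3)
proof (induction k arbitrary: f)
  case 0
  then show ?case using bounded_linear.continuous_on[OF assms(2)] by simp
next
  case (Suc k)
  show ?case
  proof (rule Ck_on_SucI[OF assms(1)])
    show "((\<lambda>x. L (f x)) has_derivative (\<lambda>v. L (frechet_derivative f (at x) v))) (at x)"
      if "x \<in> S" for x
      using bounded_linear.has_derivative[OF assms(2) Ck_on_SucD[OF Suc.prems that]] .
    show "Ck_on k S (\<lambda>x. L (frechet_derivative f (at x) v))" for v
      using Suc by simp
  qed
qed

lemma Ck_on_ident: "open S \<Longrightarrow> Ck_on k S (\<lambda>x. x)"
proof (induction k)
  case (Suc k)
  show ?case by (rule Ck_on_SucI[where f' = "\<lambda>_ v. v"]) (use Suc Ck_on_const in auto)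
qed simp

lemma Ck_on_add:
  assumes "open S" "Ck_on k S f" "Ck_on k S h"
  shows "Ck_on k S (\<lambda>x. f x + h x)"
  using assms(2,3)
proof (induction k arbitrary: f h)
  case 0
  then show ?case by (simp add: continuous_on_add)
next
  case (Suc k)
  show ?case
  proof (rule Ck_on_SucI[OF assms(1)])
    show "((\<lambda>x. f x + h x) has_derivative
        (\<lambda>v. frechet_derivative f (at x) v + frechet_derivative h (at x) v)) (at x)" if "x \<in> S" for x
      using that Suc.prems by (intro has_derivative_add Ck_on_SucD)
    show "Ck_on k S (\<lambda>x. frechet_derivative f (at x) v + frechet_derivative h (at x) v)" for v
      using Suc by simp
  qed
qed

lemma Ck_on_mult:
  fixes f h :: "'e::euclidean_space \<Rightarrow> real"
  assumes "open S" "Ck_on k S f" "Ck_on k S h"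
  shows "Ck_on k S (\<lambda>x. f x * h x)"
  using assms(2,3)
proof (induction k arbitrary: f h)
  case 0
  then show ?case by (simp add: continuous_on_mult)
next
  case (Suc k)
  show ?case
  proof (rule Ck_on_SucI[OF assms(1)])
    show "((\<lambda>x. f x * h x) has_derivative
        (\<lambda>v. f x * frechet_derivative h (at x) v + frechet_derivative f (at x) v * h x)) (at x)"
      if "x \<in> S" for x
      using that Suc.prems by (intro has_derivative_mult Ck_on_SucD)
    show "Ck_on k S (\<lambda>x. f x * frechet_derivative h (at x) v + frechet_derivative f (at x) v * h x)" for v
      \<comment> \<open>The Leibniz formula contains f and h themselves, which have to be lowered
        from order k + 1 to order k before the induction hypothesis applies.\<close>
      using Suc Ck_on_Suc_imp[OF Suc.prems(1)] Ck_on_Suc_imp[OF Suc.prems(2)]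
      by (intro Ck_on_add[OF assms(1)] Suc.IH) auto
  qed
qed

lemma Ck_on_sum:
  assumes "open S" "\<And>i. i \<in> I \<Longrightarrow> Ck_on k S (f i)"
  shows "Ck_on k S (\<lambda>x. \<Sum>i\<in>I. f i x)"
  using assms(2)
  by (induction I rule: infinite_finite_induct) (auto simp: Ck_on_const Ck_on_add assms(1))

text \<open>In the chain rule the direction in which f is differentiated varies with x, so the
  induction hypothesis does not apply directly. Expanding that direction in the basis gives a sum of
  products in which only partial derivatives of f in fixed directions are composed with h.\<close>

lemma Ck_on_compose:
  fixes f :: "'d::euclidean_space \<Rightarrow> real" and h :: "'e::euclidean_space \<Rightarrow> 'd"
  assumes "open S" "open T" "h ` S \<subseteq> T" "Ck_on k T f" "Ck_on k S h"
  shows "Ck_on k S (\<lambda>x. f (h x))"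
  using assms(4,5)
proof (induction k arbitrary: f)
  case 0
  then show ?case using continuous_on_compose2[OF _ _ assms(3)] by auto
next
  case (Suc k)
  let ?f' = "\<lambda>x. frechet_derivative f (at (h x))"
  let ?h' = "\<lambda>x. frechet_derivative h (at x)"
  let ?D = "\<lambda>x v. \<Sum>i\<in>Basis. (?h' x v \<bullet> i) * ?f' x i"
  show ?case
  proof (rule Ck_on_SucI[OF assms(1)])
    show "((\<lambda>x. f (h x)) has_derivative ?D x) (at x)" if x: "x \<in> S" for x
    proof -
      have f: "(f has_derivative ?f' x) (at (h x))"
        using Suc.prems(1) x assms(3) by (intro Ck_on_SucD) auto
      have "((\<lambda>x. f (h x)) has_derivative (\<lambda>v. ?f' x (?h' x v))) (at x)"
        using has_derivative_compose[OF Ck_on_SucD[OF Suc.prems(2) x] f] .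
      moreover have "?f' x (?h' x v) = ?D x v" for v
      proof -
        have lin: "linear (?f' x)" using f has_derivative_linear by blast
        have "?f' x (?h' x v) = ?f' x (\<Sum>i\<in>Basis. (?h' x v \<bullet> i) *\<^sub>R i)"
          by (simp add: euclidean_representation)
        also have "\<dots> = ?D x v"
          by (simp add: linear_sum[OF lin] linear_scale[OF lin])
        finally show ?thesis .
      qed
      ultimately show ?thesis by simp
    qed
    show "Ck_on k S (\<lambda>x. ?D x v)" for v
    proof (intro Ck_on_sum Ck_on_mult assms(1))
      show "Ck_on k S (\<lambda>x. ?h' x v \<bullet> i)" for i
        using Suc.prems(2) by (intro Ck_on_bounded_linear[OF assms(1) bounded_linear_inner_left]) simp
      show "Ck_on k S (\<lambda>x. ?f' x i)" for i
        using Suc.IH[of "\<lambda>y. frechet_derivative f (at y) i"] Suc.prems Ck_on_Suc_imp by auto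
    qed
  qed
qed

text \<open>The derivative of 1/f is a product of 1/f, 1/f and f' up to sign. Hence the claim for
  1/f at order k is itself the ingredient for order k + 1.\<close>

lemma Ck_on_inverse:
  fixes f :: "'e::euclidean_space \<Rightarrow> real"
  assumes "open S" "\<And>x. x \<in> S \<Longrightarrow> f x \<noteq> 0" "Ck_on k S f"
  shows "Ck_on k S (\<lambda>x. inverse (f x))"
  using assms(3)
proof (induction k)
  case 0
  then show ?case using assms(2) by (auto intro: continuous_on_inverse)
next
  case (Suc k)
  show ?case
  proof (rule Ck_on_SucI[OF assms(1)])
    show "((\<lambda>x. inverse (f x)) has_derivative
        (\<lambda>v. (- 1) * (inverse (f x) * frechet_derivative f (at x) v * inverse (f x)))) (at x)"
      if "x \<in> S" for x
      using Deriv.has_derivative_inverse[OF assms(2)[OF that] Ck_on_SucD[OF Suc.prems that]] by simp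
    show "Ck_on k S (\<lambda>x. (- 1) * (inverse (f x) * frechet_derivative f (at x) v * inverse (f x)))" for v
      using Suc Ck_on_Suc_imp[OF Suc.prems] by (intro Ck_on_mult assms(1) Ck_on_const) auto
  qed
qed

section \<open>The same rules for all orders of differentiability at once\<close>

lemma smooth_on_cong:
  assumes "open S" "\<And>x. x \<in> S \<Longrightarrow> f x = h x" "smooth_on S f"
  shows "smooth_on S h"
  using assms Ck_on_cong unfolding smooth_on_def by metis

lemma smooth_on_subset: "smooth_on S f \<Longrightarrow> T \<subseteq> S \<Longrightarrow> smooth_on T f"
  using Ck_on_subset unfolding smooth_on_def by blast

lemma smooth_on_locally:
  assumes "\<And>x. x \<in> S \<Longrightarrow> \<exists>T. open T \<and> x \<in> T \<and> smooth_on T f"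
  shows "smooth_on S f"
  using assms Ck_on_locally unfolding smooth_on_def by metis

lemma smooth_on_continuous_on: "smooth_on S f \<Longrightarrow> continuous_on S f"
  unfolding smooth_on_def using Ck_on.simps(1) by blast

lemma smooth_on_const: "open S \<Longrightarrow> smooth_on S (\<lambda>x. c)"
  by (simp add: smooth_on_def Ck_on_const)

lemma smooth_on_ident: "open S \<Longrightarrow> smooth_on S (\<lambda>x. x)"
  by (simp add: smooth_on_def Ck_on_ident)

lemma smooth_on_bounded_linear:
  "open S \<Longrightarrow> bounded_linear L \<Longrightarrow> smooth_on S f \<Longrightarrow> smooth_on S (\<lambda>x. L (f x))"
  by (simp add: smooth_on_def Ck_on_bounded_linear)

lemma smooth_on_add:
  "open S \<Longrightarrow> smooth_on S f \<Longrightarrow> smooth_on S h \<Longrightarrow> smooth_on S (\<lambda>x. f x + h x)"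
  by (simp add: smooth_on_def Ck_on_add)

lemma smooth_on_mult:
  fixes f h :: "'e::euclidean_space \<Rightarrow> real"
  shows "open S \<Longrightarrow> smooth_on S f \<Longrightarrow> smooth_on S h \<Longrightarrow> smooth_on S (\<lambda>x. f x * h x)"
  by (simp add: smooth_on_def Ck_on_mult)

lemma smooth_on_inverse:
  fixes f :: "'e::euclidean_space \<Rightarrow> real"
  shows "open S \<Longrightarrow> (\<And>x. x \<in> S \<Longrightarrow> f x \<noteq> 0) \<Longrightarrow> smooth_on S f \<Longrightarrow> smooth_on S (\<lambda>x. inverse (f x))"
  by (simp add: smooth_on_def Ck_on_inverse)

lemma smooth_on_compose:
  fixes f :: "'d::euclidean_space \<Rightarrow> real" and h :: "'e::euclidean_space \<Rightarrow> 'd"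
  shows "open S \<Longrightarrow> open T \<Longrightarrow> h ` S \<subseteq> T \<Longrightarrow> smooth_on T f \<Longrightarrow> smooth_on S h \<Longrightarrow>
    smooth_on S (\<lambda>x. f (h x))"
  by (simp add: smooth_on_def Ck_on_compose)

lemma smooth_on_frechet_derivative:
  "smooth_on S f \<Longrightarrow> smooth_on S (\<lambda>x. frechet_derivative f (at x) v)"
  unfolding smooth_on_def by (metis Ck_on.simps(2))

lemma smooth_on_has_derivative:
  "smooth_on S f \<Longrightarrow> x \<in> S \<Longrightarrow> (f has_derivative frechet_derivative f (at x)) (at x)"
  unfolding smooth_on_def using Ck_on_SucD by blast

subsection \<open>Bump functions\<close>

text \<open>The exponent m is there to make the family closed under differentiation up to linear
  combinations; m = 0 is the classical flat function exp(-1/x).\<close>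

definition flat_fun :: "nat \<Rightarrow> real \<Rightarrow> real" where
  "flat_fun m x = (if x > 0 then (1 / x) ^ m * exp (- (1 / x)) else 0)"

lemma flat_fun_tendsto: "(flat_fun m \<longlongrightarrow> 0) (at 0)"
proof -
  have "filterlim (\<lambda>x::real. (1 / x) ^ m * exp (- (1 / x))) (nhds 0) (at_right 0)"
    by real_asymp
  then have "(flat_fun m \<longlongrightarrow> 0) (at_right 0)"
    by (rule Lim_transform_eventually) (auto simp: flat_fun_def eventually_at_filter)
  moreover have "(flat_fun m \<longlongrightarrow> 0) (at_left 0)"
    by (rule Lim_transform_eventually[OF tendsto_const]) (auto simp: flat_fun_def eventually_at_filter)
  ultimately show ?thesis by (simp add: filterlim_at_split)
qed

lemma flat_fun_has_derivative:
  "(flat_fun m has_real_derivative (flat_fun (m + 2) x - m * flat_fun (Suc m) x)) (at x)"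
proof -
  consider "x > 0" | "x < 0" | "x = 0" by linarith
  then show ?thesis
  proof cases
    case 1
    \<comment> \<open>The power rule produces the truncated exponent \<open>k - Suc 0\<close>; the
      identity used to simplify it can fail only at k = 0.\<close>
    have pow: "k = 0" if "x ^ k \<noteq> x * x ^ (k - Suc 0)" for k
      using that by (cases k) auto
    have "((\<lambda>x. (1 / x) ^ m * exp (- (1 / x))) has_real_derivative
        (flat_fun (m + 2) x - m * flat_fun (Suc m) x)) (at x)"
      using 1 by (cases m)
        (auto intro!: derivative_eq_intros simp: flat_fun_def field_simps power2_eq_square intro: pow)
    then show ?thesis
      by (rule has_field_derivative_transform_within_open[where S = "{0<..}"])
         (use 1 in \<open>auto simp: flat_fun_def\<close>)
  next
    case 2
    have "((\<lambda>x::real. 0) has_real_derivative (flat_fun (m + 2) x - m * flat_fun (Suc m) x)) (at x)"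
      using 2 by (simp add: flat_fun_def)
    then show ?thesis
      by (rule has_field_derivative_transform_within_open[where S = "{..<0}"])
         (use 2 in \<open>auto simp: flat_fun_def\<close>)
  next
    case 3
    \<comment> \<open>At the origin the difference quotient of \<open>flat_fun m\<close> is
      \<open>flat_fun (Suc m)\<close>, whose limit is already known to be 0.\<close>
    have "((\<lambda>h. (flat_fun m (0 + h) - flat_fun m 0) / h) \<longlongrightarrow> 0) (at 0)"
      by (rule Lim_transform_eventually[OF flat_fun_tendsto[of "Suc m"]])
         (auto simp: flat_fun_def eventually_at_filter field_simps)
    then show ?thesis using 3 by (simp add: DERIV_def flat_fun_def)
  qed
qed

lemma smooth_on_flat_fun: "smooth_on UNIV (flat_fun m)"
  unfolding smooth_on_def
proof
  show "Ck_on k UNIV (flat_fun m)" for k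
  proof (induction k arbitrary: m)
    case 0
    show ?case using DERIV_isCont[OF flat_fun_has_derivative]
      by (auto intro!: continuous_at_imp_continuous_on)
  next
    case (Suc k)
    show ?case
    proof (rule Ck_on_SucI)
      show "(flat_fun m has_derivative (\<lambda>v. (flat_fun (m + 2) x + (- m) * flat_fun (Suc m) x) * v)) (at x)" for x
        using flat_fun_has_derivative[of m x] by (simp add: has_field_derivative_def)
      show "Ck_on k UNIV (\<lambda>x. (flat_fun (m + 2) x + (- m) * flat_fun (Suc m) x) * v)" for v
        by (intro Ck_on_mult Ck_on_add Ck_on_const Suc) auto
    qed simp
  qed
qed

lemma flat_fun_pos: "flat_fun 0 x > 0 \<longleftrightarrow> x > 0" and flat_fun_nonneg: "flat_fun 0 x \<ge> 0"
  by (auto simp: flat_fun_def)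

text \<open>The quotient f(s) / (f(s) + f(c - s)) of flat functions is 0 where s \<le> 0 and 1 where
  s \<ge> c. The denominator is positive because s and c - s add up to c > 0. Taking s quadratic in
  x avoids the norm, which is not smooth at the centre.\<close>

lemma smooth_bump_euclidean:
  fixes a :: "'e::euclidean_space"
  assumes "r > 0"
  obtains b :: "'e \<Rightarrow> real" where "smooth_on UNIV b" "\<And>x. x \<in> ball a (r / 2) \<Longrightarrow> b x = 1"
    "\<And>x. x \<notin> cball a r \<Longrightarrow> b x = 0"
proof -
  define s where "s x = r\<^sup>2 + (- 1) * (\<Sum>i\<in>Basis. ((x - a) \<bullet> i) * ((x - a) \<bullet> i))" for x
  have s: "s x = r\<^sup>2 - (dist a x)\<^sup>2" for x
    unfolding s_def dist_norm power2_norm_eq_inner euclidean_inner[of "a - x" "a - x"]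
    by (simp add: inner_diff_left algebra_simps)
  \<comment> \<open>The value of s on the sphere of radius r/2.\<close>
  define c where "c = 3 * r\<^sup>2 / 4"
  have "c > 0" using assms by (simp add: c_def)
  define b where "b x = flat_fun 0 (s x) * inverse (flat_fun 0 (s x) + flat_fun 0 (c + (- 1) * s x))" for x
  have sm: "smooth_on UNIV s"
    unfolding s_def smooth_on_def
  proof (intro allI Ck_on_add Ck_on_mult Ck_on_const Ck_on_sum)
    show "Ck_on k UNIV (\<lambda>x. (x - a) \<bullet> i)" for i k
      using Ck_on_bounded_linear[OF open_UNIV bounded_linear_inner_left[of i]
          Ck_on_add[OF open_UNIV Ck_on_ident[OF open_UNIV] Ck_on_const[OF open_UNIV, of k "- a"]]] by simp
    then show "Ck_on k UNIV (\<lambda>x. (x - a) \<bullet> i)" for i k .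
  qed auto
  have pos: "flat_fun 0 (s x) + flat_fun 0 (c + (- 1) * s x) > 0" for x
  proof (cases "s x > 0")
    case True
    then show ?thesis using flat_fun_pos[of "s x"] flat_fun_nonneg[of "c + (- 1) * s x"] by linarith
  next
    case False
    then have "c + (- 1) * s x > 0" using \<open>c > 0\<close> by simp
    then show ?thesis using flat_fun_pos[of "c + (- 1) * s x"] flat_fun_nonneg[of "s x"] by linarith
  qed
  have comp: "smooth_on UNIV (\<lambda>x. flat_fun 0 (h x))" if "smooth_on UNIV h" for h :: "'e \<Rightarrow> real"
    using smooth_on_compose[OF open_UNIV open_UNIV _ smooth_on_flat_fun that] by simp
  show ?thesis
  proof
    show "smooth_on UNIV b"
      unfolding b_def using pos
      by (intro smooth_on_mult smooth_on_inverse smooth_on_add comp sm smooth_on_const open_UNIV)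
         (auto simp: less_le)
    show "b x = 1" if "x \<in> ball a (r / 2)" for x
    proof -
      have "(dist a x)\<^sup>2 < (r / 2)\<^sup>2" using that by (intro power_strict_mono) auto
      then have "c - s x \<le> 0" by (simp add: s c_def power_divide)
      then have "flat_fun 0 (c + (- 1) * s x) = 0" by (simp add: flat_fun_def)
      then show ?thesis using pos[of x] by (simp add: b_def)
    qed
    show "b x = 0" if "x \<notin> cball a r" for x
    proof -
      have "(dist a x)\<^sup>2 \<ge> r\<^sup>2" using that assms by (intro power_mono) auto
      then show ?thesis by (simp add: b_def s flat_fun_def)
    qed
  qed
qed

subsection \<open>Hadamard's lemma\<close>

text \<open>Differentiation under the integral sign. Each derivative in x brings out one factor t
  from the inner map a + t (x - a), so the induction has to carry an arbitrary power of t.\<close>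

lemma Ck_on_segment_integral:
  fixes f :: "'e::euclidean_space \<Rightarrow> real"
  assumes "open S" "convex S" "a \<in> S" "Ck_on k S f"
  shows "Ck_on k S (\<lambda>x. integral (cbox 0 1) (\<lambda>t::real. t ^ m * f (a + t *\<^sub>R (x - a))))"
  using assms(4)
proof (induction k arbitrary: f m)
  have seg: "a + t *\<^sub>R (x - a) \<in> S" if "x \<in> S" "t \<in> cbox 0 1" for x and t :: real
  proof -
    have "a + t *\<^sub>R (x - a) = (1 - t) *\<^sub>R a + t *\<^sub>R x" by (simp add: algebra_simps)
    then show ?thesis using that assms(2,3) by (simp add: convex_alt)
  qed
  have seg': "continuous_on (S \<times> cbox 0 1) (\<lambda>z. h (a + snd z *\<^sub>R (fst z - a)))"
    if "continuous_on S h" for h :: "'e \<Rightarrow> 'g::topological_space"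
    by (rule continuous_on_compose2[OF that]) (auto intro!: continuous_intros seg)
  {
    case 0
    then show ?case
      unfolding Ck_on.simps
      by (intro integral_continuous_on_param) 
        (use seg'[of f] in \<open>auto simp: split_beta intro!: continuous_intros\<close>)
  next
    case (Suc k)
    \<comment> \<open>The Leibniz rule for integrals asks for the derivative as a continuous family
      of bounded linear maps. In finite dimension continuity in each direction suffices.\<close>
    define D where "D y = Blinfun (frechet_derivative f (at y))" for y
    define h where "h = (\<lambda>v y. frechet_derivative f (at y) v)"
    have D: "blinfun_apply (D y) v = h v y" if "y \<in> S" for y v
      using Ck_on_SucD[OF Suc.prems that] has_derivative_bounded_linear
      by (auto simp: D_def h_def bounded_linear_Blinfun_apply)
    have h: "Ck_on k S (h v)" for v
      using Suc.prems by (simp add: h_def)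
    have h0: "continuous_on S (h v)" for v
      using Ck_on_imp_continuous_on[OF h] .
    have contD: "continuous_on S D"
      by (rule continuous_on_blinfun_componentwise) (use h0 D in \<open>metis (no_types, lifting) continuous_on_cong\<close>)
    have contf: "continuous_on S f"
      using Suc.prems Ck_on_SucD has_derivative_continuous
      by (intro continuous_at_imp_continuous_on) blast
    define fx where "fx x t = t ^ Suc m *\<^sub>R D (a + t *\<^sub>R (x - a))" for x and t :: real
    have contfx: "continuous_on (S \<times> cbox 0 1) (\<lambda>(x, t). fx x t)"
      unfolding fx_def split_beta by (intro continuous_intros seg'[OF contD])
    show ?case
    proof (rule Ck_on_SucI[OF assms(1)])
      fix x assume x: "x \<in> S"
      have "((\<lambda>x. integral (cbox 0 1) (\<lambda>t. t ^ m * f (a + t *\<^sub>R (x - a)))) has_derivative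
          integral (cbox 0 1) (fx x)) (at x within S)"
      proof (rule leibniz_rule[OF _ _ contfx x assms(2)])
        fix y and t :: real assume yt: "y \<in> S" "t \<in> cbox 0 1"
        let ?z = "a + t *\<^sub>R (y - a)"
        have f: "(f has_derivative (\<lambda>v. h v ?z)) (at ?z)"
          using Ck_on_SucD[OF Suc.prems seg[OF yt]] by (simp add: h_def)
        have aff: "((\<lambda>y. a + t *\<^sub>R (y - a)) has_derivative (\<lambda>v. t *\<^sub>R v)) (at y within S)"
          by (auto intro!: derivative_eq_intros)
        have "((\<lambda>y. t ^ m * f (a + t *\<^sub>R (y - a))) has_derivative (\<lambda>v. t ^ m * h (t *\<^sub>R v) ?z)) (at y within S)"
          by (intro has_derivative_mult_right has_derivative_compose[OF aff f])
        moreover have "t ^ m * h (t *\<^sub>R v) ?z = fx y t v" for v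
        proof -
          have "h (t *\<^sub>R v) ?z = t * h v ?z"
            using D[OF seg[OF yt]] by (metis blinfun.scaleR_right real_scaleR_def)
          then show ?thesis
            by (simp add: fx_def blinfun.scaleR_left D[OF seg[OF yt]])
        qed
        ultimately show "((\<lambda>y. t ^ m * f (a + t *\<^sub>R (y - a))) has_derivative (fx y t)) (at y within S)"
          by simp
      next
        fix y assume y: "y \<in> S"
        have "continuous_on (cbox 0 1) (\<lambda>t. f (a + t *\<^sub>R (y - a)))"
          by (rule continuous_on_compose2[OF contf]) (auto intro!: continuous_intros seg y)
        then show "(\<lambda>t. t ^ m * f (a + t *\<^sub>R (y - a))) integrable_on cbox 0 1"
          by (intro integrable_continuous continuous_intros)
      qed
      moreover have "blinfun_apply (integral (cbox 0 1) (fx x)) = (\<lambda>v.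
          integral (cbox 0 1) (\<lambda>t. t ^ Suc m * h v (a + t *\<^sub>R (x - a))))"
      proof
        fix v
        have "continuous_on (cbox 0 1) (fx x)"
          unfolding fx_def
          by (intro continuous_intros continuous_on_compose2[OF contD]) (auto intro!: continuous_intros seg x)
        then have "fx x integrable_on cbox 0 1" by (rule integrable_continuous)
        then have "integral (cbox 0 1) (fx x) v = integral (cbox 0 1) (\<lambda>t. fx x t v)"
          by (rule blinfun_apply_integral)
        also have "\<dots> = integral (cbox 0 1) (\<lambda>t. t ^ Suc m * h v (a + t *\<^sub>R (x - a)))"
          by (rule integral_cong) (use seg[OF x] in \<open>simp add: fx_def blinfun.scaleR_left D\<close>)
        finally show "integral (cbox 0 1) (fx x) v =
          integral (cbox 0 1) (\<lambda>t. t ^ Suc m * h v (a + t *\<^sub>R (x - a)))" .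
      qed
      ultimately show "((\<lambda>x. integral (cbox 0 1) (\<lambda>t. t ^ m * f (a + t *\<^sub>R (x - a)))) has_derivative
          (\<lambda>v. integral (cbox 0 1) (\<lambda>t. t ^ Suc m * h v (a + t *\<^sub>R (x - a))))) (at x)"
        using at_within_open[OF x assms(1)] by (simp only:)
    next
      show "Ck_on k S (\<lambda>x. integral (cbox 0 1) (\<lambda>t. t ^ Suc m * h v (a + t *\<^sub>R (x - a))))" for v
        by (rule Suc.IH[OF h])
    qed
  }
qed

text \<open>Along the segment from a to x, f(x) - f(a) is the integral of the derivative in
  direction x - a. Splitting that direction into coordinates leaves as factors the averages of the
  partial derivatives over the segment.\<close>

lemma hadamard:
  fixes f :: "'e::euclidean_space \<Rightarrow> real"
  assumes "open S" "convex S" "a \<in> S" "smooth_on S f"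
  obtains h where "\<And>i. smooth_on S (h i)" "\<And>i. h i a = frechet_derivative f (at a) i"
    "\<And>x. x \<in> S \<Longrightarrow> f x = f a + (\<Sum>i\<in>Basis. ((x - a) \<bullet> i) * h i x)"
proof
  \<comment> \<open>The factor \<open>t ^ 0\<close> makes this the case m = 0 of the preceding
    lemma.\<close>
  define h where "h i x = integral (cbox 0 1)
    (\<lambda>t::real. t ^ 0 * (\<lambda>y. frechet_derivative f (at y) i) (a + t *\<^sub>R (x - a)))" for i x
  show "smooth_on S (h i)" for i
    unfolding smooth_on_def h_def
    using smooth_on_frechet_derivative[OF assms(4)] assms(1-3)
    by (intro allI Ck_on_segment_integral) (auto simp: smooth_on_def)
  show "h i a = frechet_derivative f (at a) i" for i
    by (simp add: h_def)
  fix x assume x: "x \<in> S"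
  let ?y = "\<lambda>t::real. a + t *\<^sub>R (x - a)"
  let ?D = "\<lambda>t. frechet_derivative f (at (?y t))"
  have seg: "?y t \<in> S" if "t \<in> cbox 0 1" for t :: real
  proof -
    have "?y t = (1 - t) *\<^sub>R a + t *\<^sub>R x" by (simp add: algebra_simps)
    then show ?thesis using that x assms(2,3) by (simp add: convex_alt)
  qed
  have D: "?D t (x - a) = (\<Sum>i\<in>Basis. ((x - a) \<bullet> i) * ?D t i)" if "t \<in> cbox 0 1" for t
  proof -
    have lin: "linear (?D t)"
      using smooth_on_has_derivative[OF assms(4) seg[OF that]] has_derivative_linear by blast
    have "?D t (x - a) = ?D t (\<Sum>i\<in>Basis. ((x - a) \<bullet> i) *\<^sub>R i)"
      by (simp only: euclidean_representation)
    also have "\<dots> = (\<Sum>i\<in>Basis. ((x - a) \<bullet> i) * ?D t i)"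
      by (simp add: linear_sum[OF lin] linear_scale[OF lin])
    finally show ?thesis .
  qed
  have int: "(\<lambda>t. ?D t i) integrable_on cbox 0 1" for i
  proof (rule integrable_continuous)
    show "continuous_on (cbox 0 1) (\<lambda>t. ?D t i)"
      by (rule continuous_on_compose2[OF smooth_on_continuous_on[OF smooth_on_frechet_derivative[OF assms(4)]]])
        (auto intro!: continuous_intros seg)
  qed
  have "((\<lambda>t. ?D t (x - a)) has_integral (f (?y 1) - f (?y 0))) {0..1}"
  proof (rule fundamental_theorem_of_calculus)
    fix t :: real assume t: "t \<in> {0..1}"
    have "((\<lambda>t. f (?y t)) has_derivative (\<lambda>s. ?D t (s *\<^sub>R (x - a)))) (at t within {0..1})"
      by (rule has_derivative_compose[where g = f])
        (use t seg in \<open>auto intro!: derivative_eq_intros smooth_on_has_derivative[OF assms(4)]\<close>)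
    moreover have "linear (?D t)"
      using smooth_on_has_derivative[OF assms(4) seg] t has_derivative_linear by auto
    ultimately show "((\<lambda>t. f (?y t)) has_vector_derivative ?D t (x - a)) (at t within {0..1})"
      by (simp add: has_vector_derivative_def linear_scale)
  qed simp
  then have "f x - f a = integral (cbox 0 1) (\<lambda>t. ?D t (x - a))"
    by (simp add: integral_unique)
  also have "\<dots> = integral (cbox 0 1) (\<lambda>t. \<Sum>i\<in>Basis. ((x - a) \<bullet> i) * ?D t i)"
    by (rule integral_cong) (rule D)
  also have "\<dots> = (\<Sum>i\<in>Basis. integral (cbox 0 1) (\<lambda>t. ((x - a) \<bullet> i) * ?D t i))"
    by (rule integral_sum) (use int in \<open>auto intro!: integrable_on_mult_right\<close>)
  also have "\<dots> = (\<Sum>i\<in>Basis. ((x - a) \<bullet> i) * h i x)"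
    by (simp add: h_def)
  finally show "f x = f a + (\<Sum>i\<in>Basis. ((x - a) \<bullet> i) * h i x)" by simp
qed

lemma sum_fun_apply: "(\<Sum>i\<in>I. F i) x = (\<Sum>i\<in>I. F i x)"
  by (induction I rule: infinite_finite_induct) auto

subsection \<open>Smooth functions on manifolds\<close>

locale manifold =
  fixes A :: "('a::{t2_space, second_countable_topology}, 'e::euclidean_space) atlas"
  assumes smooth_manifold: "smooth_manifold A"
begin

lemma chart_at:
  obtains U \<phi> where "(U, \<phi>) \<in> A" "p \<in> U"
  using smooth_manifold unfolding smooth_manifold_def by blast

context
  fixes U \<phi> assumes chart: "(U, \<phi>) \<in> A"
begin

lemma chart_homeomorphism: "homeomorphism U (\<phi> ` U) \<phi> (inv_into U \<phi>)"
  using smooth_manifold chart unfolding smooth_manifold_def by blast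

lemma open_chart: "open U" "open (\<phi> ` U)"
  using smooth_manifold chart unfolding smooth_manifold_def by blast+

lemma chart_inverse: "q \<in> U \<Longrightarrow> inv_into U \<phi> (\<phi> q) = q"
  using chart_homeomorphism homeomorphism_apply1 by blast

lemma open_chart_image:
  assumes "open W" "W \<subseteq> U"
  shows "open (\<phi> ` W)"
proof -
  have "\<phi> ` W = \<phi> ` U \<inter> inv_into U \<phi> -` W"
    using chart_inverse assms(2) by (auto simp: subset_iff)
  then show ?thesis
    using continuous_open_preimage[OF homeomorphism_cont2[OF chart_homeomorphism] open_chart(2) assms(1)]
    by simp
qed

lemma open_chart_preimage:
  assumes "open B"
  shows "open {q \<in> U. \<phi> q \<in> B}"
proof -
  have "{q \<in> U. \<phi> q \<in> B} = U \<inter> \<phi> -` B" by auto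
  then show ?thesis
    using continuous_open_preimage[OF homeomorphism_cont1[OF chart_homeomorphism] open_chart(1) assms]
    by simp
qed

end

lemma smooth_functionsD:
  "f \<in> smooth_functions A \<Longrightarrow> (U, \<phi>) \<in> A \<Longrightarrow> smooth_on (\<phi> ` U) (f \<circ> inv_into U \<phi>)"
  unfolding smooth_functions_def by blast

text \<open>Near a point, the expression of f in any other chart is the given one composed with a
  transition map.\<close>

lemma smooth_functionsI:
  assumes "\<And>p. \<exists>U \<phi> W. (U, \<phi>) \<in> A \<and> open W \<and> p \<in> W \<and> W \<subseteq> U \<and> smooth_on (\<phi> ` W) (f \<circ> inv_into U \<phi>)"
  shows "f \<in> smooth_functions A"
proof -
  have "smooth_on (\<psi> ` V) (f \<circ> inv_into V \<psi>)" if V: "(V, \<psi>) \<in> A" for V \<psi>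
  proof (rule smooth_on_locally)
    fix y assume "y \<in> \<psi> ` V"
    then obtain p where p: "p \<in> V" "y = \<psi> p" by blast
    obtain U \<phi> W where W: "(U, \<phi>) \<in> A" "open W" "p \<in> W" "W \<subseteq> U"
      "smooth_on (\<phi> ` W) (f \<circ> inv_into U \<phi>)"
      using assms[of p] by blast
    let ?T = "\<psi> ` (V \<inter> W)"
    have T: "open ?T"
      using open_chart_image[OF V, of "V \<inter> W"] open_chart[OF V] W(2) by blast
    have "smooth_on (\<psi> ` (V \<inter> U)) (\<phi> \<circ> inv_into V \<psi>)"
      using smooth_manifold V W(1) unfolding smooth_manifold_def by blast
    then have trans: "smooth_on ?T (\<phi> \<circ> inv_into V \<psi>)"
      by (rule smooth_on_subset) (use W(4) in auto)
    have "smooth_on ?T (\<lambda>x. (f \<circ> inv_into U \<phi>) ((\<phi> \<circ> inv_into V \<psi>) x))"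
      by (rule smooth_on_compose[OF T open_chart_image[OF W(1,2,4)] _ W(5) trans])
        (auto simp: chart_inverse[OF V])
    then have "smooth_on ?T (f \<circ> inv_into V \<psi>)"
      by (rule smooth_on_cong[OF T, rotated])
        (use W(4) in \<open>auto simp: chart_inverse[OF V] chart_inverse[OF W(1)] subset_iff\<close>)
    then show "\<exists>T. open T \<and> y \<in> T \<and> smooth_on T (f \<circ> inv_into V \<psi>)"
      using T p W(3) by blast
  qed
  then show ?thesis unfolding smooth_functions_def by blast
qed

lemma smooth_functions_locally:
  assumes "\<And>p. \<exists>h\<in>smooth_functions A. \<exists>W. open W \<and> p \<in> W \<and> (\<forall>q\<in>W. f q = h q)"
  shows "f \<in> smooth_functions A"
proof (rule smooth_functionsI)
  fix p
  obtain h W where h: "h \<in> smooth_functions A" "open W" "p \<in> W" "\<And>q. q \<in> W \<Longrightarrow> f q = h q"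
    using assms[of p] by blast
  obtain U \<phi> where U: "(U, \<phi>) \<in> A" "p \<in> U" using chart_at by blast
  have W: "open (U \<inter> W)" using open_chart[OF U(1)] h(2) by blast
  have "smooth_on (\<phi> ` (U \<inter> W)) (h \<circ> inv_into U \<phi>)"
    by (rule smooth_on_subset[OF smooth_functionsD[OF h(1) U(1)]]) auto
  then have "smooth_on (\<phi> ` (U \<inter> W)) (f \<circ> inv_into U \<phi>)"
    by (rule smooth_on_cong[OF open_chart_image[OF U(1) W], rotated 2])
      (auto simp: chart_inverse[OF U(1)] h(4))
  then show "\<exists>U \<phi> W. (U, \<phi>) \<in> A \<and> open W \<and> p \<in> W \<and> W \<subseteq> U \<and> smooth_on (\<phi> ` W) (f \<circ> inv_into U \<phi>)"
    using U W h(3) by (intro exI[of _ U] exI[of _ \<phi>] exI[of _ "U \<inter> W"]) auto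
qed

lemma smooth_const: "(\<lambda>_. c) \<in> smooth_functions A"
  unfolding smooth_functions_def using open_chart by (auto simp: comp_def intro!: smooth_on_const)

lemma smooth_zero: "0 \<in> smooth_functions A" and smooth_one: "1 \<in> smooth_functions A"
  using smooth_const[of 0] smooth_const[of 1] by (simp_all add: zero_fun_def one_fun_def)

lemma smooth_add: "f \<in> smooth_functions A \<Longrightarrow> h \<in> smooth_functions A \<Longrightarrow> f + h \<in> smooth_functions A"
  unfolding smooth_functions_def using open_chart
  by (auto simp: comp_def plus_fun_def intro!: smooth_on_add)

lemma smooth_mult: "f \<in> smooth_functions A \<Longrightarrow> h \<in> smooth_functions A \<Longrightarrow> f * h \<in> smooth_functions A"
  unfolding smooth_functions_def using open_chart
  by (auto simp: comp_def times_fun_def intro!: smooth_on_mult)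

lemma smooth_cmult: "f \<in> smooth_functions A \<Longrightarrow> (\<lambda>p. c * f p) \<in> smooth_functions A"
  using smooth_mult[OF smooth_const[of c], of f] by (simp add: times_fun_def)

lemma smooth_uminus: "f \<in> smooth_functions A \<Longrightarrow> - f \<in> smooth_functions A"
  using smooth_cmult[of f "- 1"] by (simp add: fun_Compl_def)

lemma smooth_diff: "f \<in> smooth_functions A \<Longrightarrow> h \<in> smooth_functions A \<Longrightarrow> f - h \<in> smooth_functions A"
  using smooth_add[of f "- h"] smooth_uminus[of h] by simp

lemma smooth_sum: "(\<And>i. i \<in> I \<Longrightarrow> f i \<in> smooth_functions A) \<Longrightarrow> (\<Sum>i\<in>I. f i) \<in> smooth_functions A"
  by (induction I rule: infinite_finite_induct) (auto simp: smooth_zero smooth_add)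

text \<open>The open sets W and the complement of C cover the manifold, and h vanishes on the
  second. Closedness of C in the whole manifold, not merely in the chart, is essential.\<close>

lemma smooth_extend_by_zero:
  assumes "(U, \<phi>) \<in> A" "open W" "W \<subseteq> U" "closed C" "C \<subseteq> W"
    and "smooth_on (\<phi> ` W) (h \<circ> inv_into U \<phi>)" "\<And>q. q \<notin> C \<Longrightarrow> h q = 0"
  shows "h \<in> smooth_functions A"
proof (rule smooth_functionsI)
  fix p
  show "\<exists>U \<phi> W. (U, \<phi>) \<in> A \<and> open W \<and> p \<in> W \<and> W \<subseteq> U \<and> smooth_on (\<phi> ` W) (h \<circ> inv_into U \<phi>)"
  proof (cases "p \<in> W")
    case True
    then show ?thesis using assms by blast
  next
    case False
    obtain V \<psi> where V: "(V, \<psi>) \<in> A" "p \<in> V" using chart_at by blast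
    have W: "open (V - C)" using open_chart[OF V(1)] assms(4) by blast
    note oW = open_chart_image[OF V(1) W]
    have "smooth_on (\<psi> ` (V - C)) (h \<circ> inv_into V \<psi>)"
      by (rule smooth_on_cong[OF oW _ smooth_on_const[OF oW, of 0]])
        (auto simp: chart_inverse[OF V(1)] assms(7))
    then show ?thesis using V W False assms(5) by blast
  qed
qed

lemma bump_function:
  assumes "open W" "p \<in> W"
  obtains \<rho> N C where "\<rho> \<in> smooth_functions A" "open N" "p \<in> N" "N \<subseteq> C" "closed C" "C \<subseteq> W"
    "\<And>q. q \<in> N \<Longrightarrow> \<rho> q = 1" "\<And>q. q \<notin> C \<Longrightarrow> \<rho> q = 0"
proof -
  obtain U \<phi> where U: "(U, \<phi>) \<in> A" "p \<in> U" using chart_at by blast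
  note inv = chart_inverse[OF U(1)]
  have W': "open (U \<inter> W)" using open_chart[OF U(1)] assms(1) by blast
  obtain r where r: "r > 0" "cball (\<phi> p) r \<subseteq> \<phi> ` (U \<inter> W)"
    using open_chart_image[OF U(1) W'] assms(2) U(2) open_contains_cball
    by (metis IntI Int_lower1 imageI)
  obtain b :: "'e \<Rightarrow> real" where b: "smooth_on UNIV b" "\<And>x. x \<in> ball (\<phi> p) (r / 2) \<Longrightarrow> b x = 1"
    "\<And>x. x \<notin> cball (\<phi> p) r \<Longrightarrow> b x = 0"
    using smooth_bump_euclidean[OF r(1)] by metis
  define \<rho> where "\<rho> q = (if q \<in> U then b (\<phi> q) else 0)" for q
  define C where "C = inv_into U \<phi> ` cball (\<phi> p) r"
  define N where "N = {q \<in> U. \<phi> q \<in> ball (\<phi> p) (r / 2)}"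
  \<comment> \<open>The chart gives compactness; the Hausdorff property then makes C closed in the
    whole manifold, which excludes a jump at the boundary of U.\<close>
  have "compact C"
    unfolding C_def
    by (intro compact_continuous_image continuous_on_subset[OF homeomorphism_cont2[OF chart_homeomorphism[OF U(1)]]])
      (use r in auto)
  then have C: "closed C" by (rule compact_imp_closed)
  have CW: "C \<subseteq> U \<inter> W"
    using r(2) inv unfolding C_def by (force simp: subset_iff)
  then have CU: "C \<subseteq> U" by blast
  have zero: "\<rho> q = 0" if "q \<notin> C" for q
  proof (cases "q \<in> U")
    case True
    then have "\<phi> q \<notin> cball (\<phi> p) r" using that inv[OF True] unfolding C_def by (metis imageI)
    then show ?thesis using b(3) True by (simp add: \<rho>_def)
  qed (simp add: \<rho>_def)
  show ?thesis
  proof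
    have "smooth_on (\<phi> ` U) b" by (rule smooth_on_subset[OF b(1)]) simp
    then have "smooth_on (\<phi> ` U) (\<rho> \<circ> inv_into U \<phi>)"
      by (rule smooth_on_cong[OF open_chart(2)[OF U(1)], rotated]) (auto simp: inv \<rho>_def)
    then show "\<rho> \<in> smooth_functions A"
      by (rule smooth_extend_by_zero[OF U(1) open_chart(1)[OF U(1)] order_refl C CU _ zero])
    show "open N" unfolding N_def using open_chart_preimage[OF U(1)] by blast
    show "p \<in> N" using U r(1) by (simp add: N_def)
    show "N \<subseteq> C"
    proof
      fix q assume q: "q \<in> N"
      then have "\<phi> q \<in> cball (\<phi> p) r" using r(1) by (auto simp: N_def)
      then show "q \<in> C" using q inv[of q] unfolding C_def N_def by force
    qed
    show "closed C" by fact
    show "C \<subseteq> W" using CW by blast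
    show "\<rho> q = 1" if "q \<in> N" for q using that b(2) by (simp add: \<rho>_def N_def)
    show "\<rho> q = 0" if "q \<notin> C" for q using zero that .
  qed
qed

text \<open>Multiplication by a bump function. The neighbourhood N is chosen before k, so that one N
  serves a whole family of functions, such as all coordinates.\<close>

lemma extend_germs:
  assumes "(U, \<phi>) \<in> A" "open W" "W \<subseteq> U" "p \<in> W"
  obtains N where "open N" "p \<in> N" "N \<subseteq> W"
    "\<And>k. smooth_on (\<phi> ` W) k \<Longrightarrow> \<exists>h\<in>smooth_functions A. \<forall>q\<in>N. h q = k (\<phi> q)"
proof -
  obtain \<rho> N C where \<rho>: "\<rho> \<in> smooth_functions A" "open N" "p \<in> N" "N \<subseteq> C" "closed C" "C \<subseteq> W"
    "\<And>q. q \<in> N \<Longrightarrow> \<rho> q = 1" "\<And>q. q \<notin> C \<Longrightarrow> \<rho> q = 0"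
    using bump_function[OF assms(2,4)] by metis
  show ?thesis
  proof
    show "open N" "p \<in> N" "N \<subseteq> W" using \<rho> by auto
    fix k :: "'e \<Rightarrow> real" assume k: "smooth_on (\<phi> ` W) k"
    define h where "h q = \<rho> q * k (\<phi> q)" for q
    note oW = open_chart_image[OF assms(1-3)]
    have "smooth_on (\<phi> ` W) (\<lambda>y. (\<rho> \<circ> inv_into U \<phi>) y * k y)"
      using smooth_on_subset[OF smooth_functionsD[OF \<rho>(1) assms(1)] image_mono[OF assms(3)]] k
      by (intro smooth_on_mult[OF oW])
    then have "smooth_on (\<phi> ` W) (h \<circ> inv_into U \<phi>)"
      by (rule smooth_on_cong[OF oW, rotated])
        (use assms(3) in \<open>auto simp: h_def chart_inverse[OF assms(1)] subset_iff\<close>)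
    then have "h \<in> smooth_functions A"
      by (rule smooth_extend_by_zero[OF assms(1-3) \<rho>(5,6)]) (simp add: h_def \<rho>(8))
    then show "\<exists>h\<in>smooth_functions A. \<forall>q\<in>N. h q = k (\<phi> q)"
      by (intro bexI[of _ h] ballI) (simp_all add: h_def \<rho>(7))
  qed
qed

text \<open>Supplies the inverse of the pivot when linear systems with smooth coefficients are
  solved by elimination.\<close>

lemma local_reciprocal:
  assumes "f \<in> smooth_functions A" "f p \<noteq> 0"
  obtains h N where "h \<in> smooth_functions A" "open N" "p \<in> N" "\<And>q. q \<in> N \<Longrightarrow> f q * h q = 1"
proof -
  obtain U \<phi> where U: "(U, \<phi>) \<in> A" "p \<in> U" using chart_at by blast
  note inv = chart_inverse[OF U(1)]
  note f = smooth_functionsD[OF assms(1) U(1)]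
  have "continuous_on (\<phi> ` U) (f \<circ> inv_into U \<phi>)" using smooth_on_continuous_on f by blast
  then have oB: "open (\<phi> ` U \<inter> (f \<circ> inv_into U \<phi>) -` (- {0}))"
    by (rule continuous_open_preimage[OF _ open_chart(2)[OF U(1)]]) auto
  define W where "W = {q \<in> U. \<phi> q \<in> \<phi> ` U \<inter> (f \<circ> inv_into U \<phi>) -` (- {0})}"
  have W: "open W" "W \<subseteq> U" "p \<in> W"
    using open_chart_preimage[OF U(1) oB] U assms(2) by (auto simp: W_def inv)
  have "smooth_on (\<phi> ` W) (\<lambda>y. inverse ((f \<circ> inv_into U \<phi>) y))"
    using smooth_on_subset[OF f image_mono[OF W(2)]]
    by (intro smooth_on_inverse[OF open_chart_image[OF U(1) W(1,2)]]) (auto simp: W_def simp del: comp_apply)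
  then obtain h N where h: "open N" "p \<in> N" "N \<subseteq> W" "h \<in> smooth_functions A"
    "\<And>q. q \<in> N \<Longrightarrow> h q = inverse ((f \<circ> inv_into U \<phi>) (\<phi> q))"
    using extend_germs[OF U(1) W] by metis
  show ?thesis
  proof
    show "f q * h q = 1" if "q \<in> N" for q
    proof -
      have "q \<in> U" "f q \<noteq> 0" using h(3) that inv[of q] by (auto simp: W_def subset_iff)
      then show ?thesis using h(5)[OF that] inv[of q] by simp
    qed
  qed (use h in auto)
qed

subsection \<open>Vector fields\<close>

context
  fixes X assumes X: "X \<in> vector_fields A"
begin

lemma vector_field_smooth: "f \<in> smooth_functions A \<Longrightarrow> X f \<in> smooth_functions A"
  using X by (simp add: vector_fields_def)

lemma vector_field_outside: "f \<notin> smooth_functions A \<Longrightarrow> X f = 0"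
  using X by (simp add: vector_fields_def)

lemma vector_field_add:
  "f \<in> smooth_functions A \<Longrightarrow> h \<in> smooth_functions A \<Longrightarrow> X (f + h) = X f + X h"
  using X by (simp add: vector_fields_def)

lemma vector_field_cmult: "f \<in> smooth_functions A \<Longrightarrow> X (\<lambda>p. c * f p) = (\<lambda>p. c * X f p)"
  using X by (simp add: vector_fields_def)

lemma vector_field_mult:
  "f \<in> smooth_functions A \<Longrightarrow> h \<in> smooth_functions A \<Longrightarrow> X (f * h) = X f * h + f * X h"
  using X by (simp add: vector_fields_def)

lemma vector_field_const: "X (\<lambda>_. c) = 0"
proof -
  have "X 1 = X 1 + X 1" using vector_field_mult[OF smooth_one smooth_one] by simp
  then have "X 1 = 0" by simp
  then show ?thesis
    using vector_field_cmult[OF smooth_one, of c] by (simp add: fun_eq_iff)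
qed

lemma vector_field_sum:
  "(\<And>i. i \<in> I \<Longrightarrow> f i \<in> smooth_functions A) \<Longrightarrow> X (\<Sum>i\<in>I. f i) = (\<Sum>i\<in>I. X (f i))"
proof (induction I rule: infinite_finite_induct)
  case (insert i I)
  then have "X (f i + (\<Sum>i\<in>I. f i)) = X (f i) + X (\<Sum>i\<in>I. f i)"
    by (intro vector_field_add smooth_sum) auto
  then show ?case using insert unfolding sum.insert[OF insert(1,2)] by (metis insertCI)
qed (use vector_field_const[of 0] in \<open>simp_all add: zero_fun_def\<close>)

text \<open>With a bump function \<rho> the products \<rho> f and \<rho> h agree everywhere. In the
  Leibniz rule at q the terms with X \<rho> are equal since f(q) = h(q), and \<rho>(q) = 1 leaves
  the claim.\<close>

lemma vector_field_local:
  assumes "f \<in> smooth_functions A" "h \<in> smooth_functions A" "open W" "q \<in> W"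
    "\<And>r. r \<in> W \<Longrightarrow> f r = h r"
  shows "X f q = X h q"
proof -
  obtain \<rho> N C where \<rho>: "\<rho> \<in> smooth_functions A" "q \<in> N" "C \<subseteq> W"
    "\<And>q. q \<in> N \<Longrightarrow> \<rho> q = 1" "\<And>q. q \<notin> C \<Longrightarrow> \<rho> q = 0"
    using bump_function[OF assms(3,4)] by metis
  have "\<rho> * f = \<rho> * h"
    using \<rho>(3,5) assms(5) by (auto simp: fun_eq_iff subset_iff)
  then have "(X \<rho> * f + \<rho> * X f) q = (X \<rho> * h + \<rho> * X h) q"
    using vector_field_mult[OF \<rho>(1)] assms(1,2) by metis
  then show ?thesis using \<rho>(2,4) assms(4,5) by simp
qed

end

definition coordinate_frame :: "'a set \<Rightarrow> ('e \<Rightarrow> 'a \<Rightarrow> real) \<Rightarrow> ('e \<Rightarrow> 'a vfield) \<Rightarrow> bool" where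
  "coordinate_frame N x E \<longleftrightarrow> open N \<and> (\<forall>i. x i \<in> smooth_functions A) \<and> (\<forall>i. E i \<in> vector_fields A) \<and>
    (\<forall>i\<in>Basis. \<forall>j\<in>Basis. \<forall>q\<in>N. E i (x j) q = (if i = j then 1 else 0)) \<and>
    (\<forall>X\<in>vector_fields A. \<forall>f\<in>smooth_functions A. \<forall>q\<in>N.
      X f q = (\<Sum>i\<in>Basis. X (x i) q * E i f q))"

lemma coordinate_frameD:
  assumes "coordinate_frame N x E"
  shows "open N" "x i \<in> smooth_functions A" "E i \<in> vector_fields A"
    "i \<in> Basis \<Longrightarrow> j \<in> Basis \<Longrightarrow> q \<in> N \<Longrightarrow> E i (x j) q = (if i = j then 1 else 0)"
    "X \<in> vector_fields A \<Longrightarrow> f \<in> smooth_functions A \<Longrightarrow> q \<in> N \<Longrightarrow>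
      X f q = (\<Sum>i\<in>Basis. X (x i) q * E i f q)"
  using assms unfolding coordinate_frame_def by blast+

lemma coordinate_frame_at: "\<exists>N x E. p \<in> N \<and> coordinate_frame N x E"
proof -
  obtain U \<phi> where U: "(U, \<phi>) \<in> A" "p \<in> U" using chart_at by blast
  note inv = chart_inverse[OF U(1)]
  obtain r where r: "r > 0" "ball (\<phi> p) r \<subseteq> \<phi> ` U"
    using open_chart(2)[OF U(1)] U(2) open_contains_ball by blast
  \<comment> \<open>A ball, because Hadamard's lemma needs a convex domain.\<close>
  define B where "B = ball (\<phi> p) r"
  define W where "W = {q \<in> U. \<phi> q \<in> B}"
  have W: "open W" "W \<subseteq> U" "p \<in> W"
    using open_chart_preimage[OF U(1), of B] U(2) r(1) by (auto simp: W_def B_def simp del: mem_ball)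
  have WB: "\<phi> ` W = B" using r(2) by (auto simp: W_def B_def)
  obtain \<rho> N1 C where \<rho>: "\<rho> \<in> smooth_functions A" "open N1" "p \<in> N1" "N1 \<subseteq> C" "closed C" "C \<subseteq> W"
    "\<And>q. q \<in> N1 \<Longrightarrow> \<rho> q = 1" "\<And>q. q \<notin> C \<Longrightarrow> \<rho> q = 0"
    using bump_function[OF W(1,3)] by metis
  obtain N2 where N2: "open N2" "p \<in> N2" "N2 \<subseteq> W"
    "\<And>k. smooth_on (\<phi> ` W) k \<Longrightarrow> \<exists>h\<in>smooth_functions A. \<forall>q\<in>N2. h q = k (\<phi> q)"
    using extend_germs[OF U(1) W] by metis
  have "\<exists>h\<in>smooth_functions A. \<forall>q\<in>N2. h q = \<phi> q \<bullet> i" for i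
    by (rule N2(4)) (intro smooth_on_bounded_linear[OF _ bounded_linear_inner_left] smooth_on_ident
        open_chart_image[OF U(1) W(1,2)])
  then obtain x where x: "\<And>i. x i \<in> smooth_functions A" "\<And>i q. q \<in> N2 \<Longrightarrow> x i q = \<phi> q \<bullet> i"
    by metis
  define D where "D f q = frechet_derivative (f \<circ> inv_into U \<phi>) (at (\<phi> q))" for f :: "'a \<Rightarrow> real" and q
  have D: "(f \<circ> inv_into U \<phi> has_derivative D f q) (at (\<phi> q))" if "f \<in> smooth_functions A" "q \<in> U" for f q
    unfolding D_def using smooth_on_has_derivative[OF smooth_functionsD[OF that(1) U(1)]] that(2) by blast
  have D_eq: "D f q = F" if "(f \<circ> inv_into U \<phi> has_derivative F) (at (\<phi> q))" for f q F
    unfolding D_def using frechet_derivative_at[OF that] by simp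
  \<comment> \<open>The factor \<rho> makes the partial derivative a field on the whole manifold;
    the value 0 for non-smooth f is the convention of \<open>vector_fields\<close>.\<close>
  define E where "E i f q = (if f \<in> smooth_functions A \<and> q \<in> U then \<rho> q * D f q i else 0)" for i f q
  have E_smooth: "E i f \<in> smooth_functions A" if f: "f \<in> smooth_functions A" for i f
  proof (rule smooth_extend_by_zero[OF U(1) open_chart(1)[OF U(1)] order_refl \<rho>(5)])
    show "C \<subseteq> U" using \<rho>(6) W(2) by blast
    show "E i f q = 0" if "q \<notin> C" for q using \<rho>(8)[OF that] by (simp add: E_def)
    have "smooth_on (\<phi> ` U) (\<lambda>y. (\<rho> \<circ> inv_into U \<phi>) y * frechet_derivative (f \<circ> inv_into U \<phi>) (at y) i)"
      by (intro smooth_on_mult smooth_on_frechet_derivative smooth_functionsD f \<rho>(1) U(1) open_chart(2)[OF U(1)])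
    then show "smooth_on (\<phi> ` U) (E i f \<circ> inv_into U \<phi>)"
      by (rule smooth_on_cong[OF open_chart(2)[OF U(1)], rotated]) (auto simp: E_def D_def f inv)
  qed
  have E_vf: "E i \<in> vector_fields A" for i
    unfolding vector_fields_def mem_Collect_eq
  proof (intro conjI allI ballI impI)
    show "E i f = 0" if "f \<notin> smooth_functions A" for f
      using that by (auto simp: E_def)
    show "E i f \<in> smooth_functions A" if "f \<in> smooth_functions A" for f
      using E_smooth that .
    fix f assume f: "f \<in> smooth_functions A"
    show "E i (\<lambda>p. c * f p) = (\<lambda>p. c * E i f p)" for c
    proof
      fix q
      have "D (\<lambda>p. c * f p) q = (\<lambda>v. c * D f q v)" if "q \<in> U"
        using has_derivative_mult_right[OF D[OF f that], of c] by (intro D_eq) (simp add: comp_def)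
      then show "E i (\<lambda>p. c * f p) q = c * E i f q"
        by (simp add: E_def f smooth_cmult)
    qed
    fix h assume h: "h \<in> smooth_functions A"
    show "E i (f + h) = E i f + E i h"
    proof
      fix q
      have "D (f + h) q = (\<lambda>v. D f q v + D h q v)" if "q \<in> U"
        using has_derivative_add[OF D[OF f that] D[OF h that]] by (intro D_eq) (simp add: comp_def)
      then show "E i (f + h) q = (E i f + E i h) q"
        using smooth_add[OF f h] by (simp add: E_def f h algebra_simps)
    qed
    show "E i (f * h) = E i f * h + f * E i h"
    proof
      fix q
      have "D (f * h) q = (\<lambda>v. f q * D h q v + D f q v * h q)" if "q \<in> U"
        using has_derivative_mult[OF D[OF f that] D[OF h that]] that
        by (intro D_eq) (simp add: comp_def inv)
      then show "E i (f * h) q = (E i f * h + f * E i h) q"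
        using smooth_mult[OF f h] by (simp add: E_def f h algebra_simps)
    qed
  qed
  let ?N = "N1 \<inter> N2"
  have EN: "E i f q = D f q i" if "q \<in> ?N" "f \<in> smooth_functions A" for i f q
    using that \<rho>(7) N2(3) W(2) by (auto simp: E_def)
  have "coordinate_frame ?N x E"
    unfolding coordinate_frame_def
  proof (intro conjI allI ballI)
    show "open ?N" using \<rho> N2 by auto
    show "x i \<in> smooth_functions A" "E i \<in> vector_fields A" for i using x E_vf by auto
    show "E i (x j) q = (if i = j then 1 else 0)" if ij: "i \<in> Basis" "j \<in> Basis" and q: "q \<in> ?N" for i j q
    proof -
      have "((\<lambda>y. y \<bullet> j) has_derivative (\<lambda>v. v \<bullet> j)) (at (\<phi> q))"
        by (rule bounded_linear.has_derivative[OF bounded_linear_inner_left has_derivative_ident])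
      then have "(x j \<circ> inv_into U \<phi> has_derivative (\<lambda>v. v \<bullet> j)) (at (\<phi> q))"
      proof (rule has_derivative_transform_within_open)
        show "open (\<phi> ` N2)" using open_chart_image[OF U(1) N2(1)] N2(3) W(2) by blast
        show "\<phi> q \<in> \<phi> ` N2" using q by blast
        show "y \<bullet> j = (x j \<circ> inv_into U \<phi>) y" if "y \<in> \<phi> ` N2" for y
          using that x(2) N2(3) W(2) inv by (auto simp: subset_iff)
      qed
      then have "E i (x j) q = i \<bullet> j"
        using D_eq EN[OF q x(1)] by simp
      then show ?thesis using ij by (simp add: inner_Basis)
    qed
    fix X f q assume X: "X \<in> vector_fields A" and f: "f \<in> smooth_functions A" and q: "q \<in> ?N"
    have qW: "q \<in> W" "q \<in> U" using q N2(3) W(2) by auto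
    have B: "open B" "convex B" "\<phi> q \<in> B" using qW WB by (auto simp: B_def)
    have fB: "smooth_on B (f \<circ> inv_into U \<phi>)"
      using smooth_on_subset[OF smooth_functionsD[OF f U(1)] r(2)] by (simp add: B_def)
    obtain h where h: "\<And>i. smooth_on B (h i)" "\<And>i. h i (\<phi> q) = D f q i"
      "\<And>y. y \<in> B \<Longrightarrow> (f \<circ> inv_into U \<phi>) y =
        (f \<circ> inv_into U \<phi>) (\<phi> q) + (\<Sum>i\<in>Basis. ((y - \<phi> q) \<bullet> i) * h i y)"
      by (rule hadamard[OF B fB, folded D_def]) (rule that)
    \<comment> \<open>A second cut-off around q: the factors h depend on f and q, whereas the
      frame's domain must not.\<close>
    obtain N3 where N3: "open N3" "q \<in> N3" "N3 \<subseteq> W"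
      "\<And>k. smooth_on B k \<Longrightarrow> \<exists>h\<in>smooth_functions A. \<forall>q\<in>N3. h q = k (\<phi> q)"
      using extend_germs[OF U(1) W(1,2) qW(1)] unfolding WB by metis
    obtain H where H: "\<And>i. H i \<in> smooth_functions A" "\<And>i q'. q' \<in> N3 \<Longrightarrow> H i q' = h i (\<phi> q')"
      using N3(4)[OF h(1)] by metis
    \<comment> \<open>The first factor vanishes at q, so the Leibniz term containing X (H i)
      disappears there.\<close>
    define G where "G i = (x i + (\<lambda>_. - (\<phi> q \<bullet> i))) * H i" for i
    have G: "G i \<in> smooth_functions A" for i
      unfolding G_def by (intro smooth_mult smooth_add x(1) smooth_const H(1))
    have "X f q = X ((\<lambda>_. f q) + (\<Sum>i\<in>Basis. G i)) q"
    proof (rule vector_field_local[OF X f])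
      show "(\<lambda>_. f q) + (\<Sum>i\<in>Basis. G i) \<in> smooth_functions A"
        by (intro smooth_add smooth_sum smooth_const G)
      show "open (N2 \<inter> N3)" "q \<in> N2 \<inter> N3" using N2 N3 q by auto
      fix s assume s: "s \<in> N2 \<inter> N3"
      then have "s \<in> W" "s \<in> U" "\<phi> s \<in> B" using N3(3) W(2) WB by auto
      then show "f s = ((\<lambda>_. f q) + (\<Sum>i\<in>Basis. G i)) s"
        using h(3)[of "\<phi> s"] s
        by (simp add: inv qW sum_fun_apply G_def x(2) H(2) inner_diff_left)
    qed
    also have "\<dots> = (\<Sum>i\<in>Basis. X (G i) q)"
      using vector_field_add[OF X smooth_const smooth_sum, of Basis G "f q"] vector_field_const[OF X]
        vector_field_sum[OF X, of Basis G] G by (simp add: sum_fun_apply)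
    also have "\<dots> = (\<Sum>i\<in>Basis. X (x i) q * E i f q)"
    proof (rule sum.cong[OF refl])
      fix i
      have "X (G i) = X (x i + (\<lambda>_. - (\<phi> q \<bullet> i))) * H i + (x i + (\<lambda>_. - (\<phi> q \<bullet> i))) * X (H i)"
        unfolding G_def by (intro vector_field_mult[OF X] smooth_add x(1) smooth_const H(1))
      moreover have "X (x i + (\<lambda>_. - (\<phi> q \<bullet> i))) = X (x i)"
        using vector_field_add[OF X x(1) smooth_const] vector_field_const[OF X] by simp
      ultimately show "X (G i) q = X (x i) q * E i f q"
        using N3(2) q by (simp add: EN[OF q f] H(2) h(2) x(2))
    qed
    finally show "X f q = (\<Sum>i\<in>Basis. X (x i) q * E i f q)" .
  qed
  then show ?thesis using \<rho>(3) N2(2) by blast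
qed

section \<open>The module of vector fields\<close>

lemma vector_fieldsI:
  assumes "\<And>f q. f \<notin> smooth_functions A \<Longrightarrow> X f q = 0"
    and "\<And>f. f \<in> smooth_functions A \<Longrightarrow> X f \<in> smooth_functions A"
    and "\<And>f h q. f \<in> smooth_functions A \<Longrightarrow> h \<in> smooth_functions A \<Longrightarrow> X (f + h) q = X f q + X h q"
    and "\<And>c f q. f \<in> smooth_functions A \<Longrightarrow> X (\<lambda>p. c * f p) q = c * X f q"
    and "\<And>f h q. f \<in> smooth_functions A \<Longrightarrow> h \<in> smooth_functions A \<Longrightarrow>
      X (f * h) q = X f q * h q + f q * X h q"
  shows "X \<in> vector_fields A"
  using assms unfolding vector_fields_def mem_Collect_eq
  by (intro conjI allI ballI impI ext) simp_all

lemma vector_field_plus: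
  assumes "X \<in> vector_fields A" "Y \<in> vector_fields A"
  shows "X + Y \<in> vector_fields A"
proof (rule vector_fieldsI)
  show "(X + Y) f \<in> smooth_functions A" if "f \<in> smooth_functions A" for f
    unfolding plus_fun_apply[of X]
    by (rule smooth_add[OF vector_field_smooth[OF assms(1) that] vector_field_smooth[OF assms(2) that]])
qed (simp_all add: vector_field_outside[OF assms(1)] vector_field_outside[OF assms(2)]
    vector_field_add[OF assms(1)] vector_field_add[OF assms(2)]
    vector_field_cmult[OF assms(1)] vector_field_cmult[OF assms(2)]
    vector_field_mult[OF assms(1)] vector_field_mult[OF assms(2)] algebra_simps)

lemma vector_field_fscale:
  assumes "u \<in> smooth_functions A" "X \<in> vector_fields A"
  shows "fscale u X \<in> vector_fields A"
proof (rule vector_fieldsI)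
  show "fscale u X f \<in> smooth_functions A" if "f \<in> smooth_functions A" for f
    unfolding fscale_def by (rule smooth_mult[OF assms(1) vector_field_smooth[OF assms(2) that]])
qed (simp_all add: fscale_def vector_field_outside[OF assms(2)] vector_field_add[OF assms(2)]
    vector_field_cmult[OF assms(2)] vector_field_mult[OF assms(2)] algebra_simps)

lemma vector_field_zero: "0 \<in> vector_fields A"
  by (rule vector_fieldsI) (simp_all add: smooth_zero)

lemma vector_field_Sum:
  "(\<And>i. i \<in> I \<Longrightarrow> X i \<in> vector_fields A) \<Longrightarrow> (\<Sum>i\<in>I. X i) \<in> vector_fields A"
  by (induction I rule: infinite_finite_induct) (auto simp: vector_field_zero vector_field_plus)

section \<open>Function-linear maps on vector fields and their tensoriality\<close>

context
  fixes L assumes L: "function_linear A fscale (vector_fields A) (*) (smooth_functions A) L"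
begin

lemma covector_smooth: "X \<in> vector_fields A \<Longrightarrow> L X \<in> smooth_functions A"
  using L by (simp add: function_linear_def)

lemma covector_add: "X \<in> vector_fields A \<Longrightarrow> Y \<in> vector_fields A \<Longrightarrow> L (X + Y) = L X + L Y"
  using L by (simp add: function_linear_def)

lemma covector_fscale: "f \<in> smooth_functions A \<Longrightarrow> X \<in> vector_fields A \<Longrightarrow> L (fscale f X) = f * L X"
  using L by (simp add: function_linear_def)

lemma covector_zero: "L 0 = 0"
proof -
  have "fscale 0 (0 :: 'a vfield) = 0" by (simp add: fscale_def fun_eq_iff)
  then show ?thesis using covector_fscale[OF smooth_zero vector_field_zero] by simp
qed

lemma covector_sum:
  "(\<And>i. i \<in> I \<Longrightarrow> X i \<in> vector_fields A) \<Longrightarrow> L (\<Sum>i\<in>I. X i) = (\<Sum>i\<in>I. L (X i))"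
proof (induction I rule: infinite_finite_induct)
  case (insert i I)
  then have "L (X i + (\<Sum>i\<in>I. X i)) = L (X i) + L (\<Sum>i\<in>I. X i)"
    by (intro covector_add vector_field_Sum) auto
  then show ?case using insert unfolding sum.insert[OF insert(1,2)] by (metis insertCI)
qed (simp_all add: covector_zero)

text \<open>If X and Y agree on W, a bump function \<rho> supported in W makes \<rho> X and \<rho> Y
  equal everywhere, and function-linearity moves \<rho> outside L.\<close>

lemma covector_local:
  assumes "X \<in> vector_fields A" "Y \<in> vector_fields A" "open W" "q \<in> W"
    "\<And>f r. f \<in> smooth_functions A \<Longrightarrow> r \<in> W \<Longrightarrow> X f r = Y f r"
  shows "L X q = L Y q"
proof -
  obtain \<rho> N C where \<rho>: "\<rho> \<in> smooth_functions A" "q \<in> N" "C \<subseteq> W"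
    "\<And>q. q \<in> N \<Longrightarrow> \<rho> q = 1" "\<And>q. q \<notin> C \<Longrightarrow> \<rho> q = 0"
    using bump_function[OF assms(3,4)] by metis
  have "fscale \<rho> X f r = fscale \<rho> Y f r" for f r
  proof (cases "f \<in> smooth_functions A")
    case True
    then show ?thesis using \<rho>(3,5) assms(5)[OF True, of r] by (cases "r \<in> C") (auto simp: fscale_def)
  next
    case False
    then show ?thesis using vector_field_outside assms(1,2) by (simp add: fscale_def)
  qed
  then have "fscale \<rho> X = fscale \<rho> Y" by (intro ext)
  then have "(\<rho> * L X) q = (\<rho> * L Y) q"
    using covector_fscale[OF \<rho>(1)] assms(1,2) by metis
  then show ?thesis using \<rho>(2,4) by simp
qed

text \<open>Tensoriality: at q, L X depends on X only through its components there. It is used for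
  1-forms and for the metric in either argument.\<close>

lemma covector_frame:
  assumes fr: "coordinate_frame N x E" and X: "X \<in> vector_fields A" and q: "q \<in> N"
  shows "L X q = (\<Sum>i\<in>Basis. X (x i) q * L (E i) q)"
proof -
  note fr = coordinate_frameD[OF fr]
  note sm = vector_field_smooth[OF X fr(2)]
  note vf = vector_field_fscale[OF sm fr(3)]
  have "L X q = L (\<Sum>i\<in>Basis. fscale (X (x i)) (E i)) q"
    by (rule covector_local[OF X vector_field_Sum[OF vf] fr(1) q])
      (simp add: fr(5)[OF X] sum_fun_apply fscale_def)
  also have "L (\<Sum>i\<in>Basis. fscale (X (x i)) (E i)) = (\<Sum>i\<in>Basis. X (x i) * L (E i))"
    using covector_sum[OF vf] covector_fscale[OF sm fr(3)] by simp
  finally show ?thesis by (simp add: sum_fun_apply)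
qed

end

text \<open>Gaussian elimination with function coefficients. Nonsingularity is required at p alone,
  as triviality of the kernel; each pivot is nonzero at p and hence near p. Unknowns and equations
  have separate index sets because one step removes an unknown k and an equation j0 that need not
  correspond.\<close>

lemma local_linear_solve:
  assumes "finite I" "finite J" "card I = card J"
    and "\<And>i j. i \<in> I \<Longrightarrow> j \<in> J \<Longrightarrow> a i j \<in> smooth_functions A" "\<And>j. j \<in> J \<Longrightarrow> b j \<in> smooth_functions A"
    and "\<And>v i. (\<And>j. j \<in> J \<Longrightarrow> (\<Sum>i\<in>I. v i * a i j p) = 0) \<Longrightarrow> i \<in> I \<Longrightarrow> v i = 0"
  shows "\<exists>c N. (\<forall>i\<in>I. c i \<in> smooth_functions A) \<and> open N \<and> p \<in> N \<and>
    (\<forall>q\<in>N. \<forall>j\<in>J. (\<Sum>i\<in>I. c i q * a i j q) = b j q)"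
  using assms
proof (induction I arbitrary: J a b rule: finite_induct)
  case empty
  then show ?case by (intro exI[of _ "\<lambda>_. 0"] exI[of _ UNIV]) auto
next
  case (insert k I)
  note a = insert.prems(3) and b = insert.prems(4)
  \<comment> \<open>If every coefficient of the unknown k vanished at p, the unit vector at k would
    lie in the kernel.\<close>
  have "\<exists>j\<in>J. a k j p \<noteq> 0"
  proof (rule ccontr)
    assume "\<not> ?thesis"
    then have "(\<Sum>i\<in>insert k I. (if i = k then 1 else 0) * a i j p) = 0" if "j \<in> J" for j
      using that by (intro sum.neutral) auto
    from insert.prems(5)[of "\<lambda>i. if i = k then 1 else 0" k, OF this] show False by simp
  qed
  then obtain j0 where j0: "j0 \<in> J" "a k j0 p \<noteq> 0" by blast
  obtain u M where u: "u \<in> smooth_functions A" "open M" "p \<in> M" "\<And>q. q \<in> M \<Longrightarrow> a k j0 q * u q = 1"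
    using local_reciprocal[OF a[OF _ j0(1), of k]] j0(2) by auto
  \<comment> \<open>The Schur complement of the pivot: the unknown k is eliminated from the other
    equations by means of equation j0.\<close>
  define a' where "a' i j = a i j - a i j0 * u * a k j" for i j
  define b' where "b' j = b j - b j0 * u * a k j" for j
  have "\<exists>c N. (\<forall>i\<in>I. c i \<in> smooth_functions A) \<and> open N \<and> p \<in> N \<and>
    (\<forall>q\<in>N. \<forall>j\<in>J - {j0}. (\<Sum>i\<in>I. c i q * a' i j q) = b' j q)"
  proof (rule insert.IH)
    show "finite (J - {j0})" using insert.prems(1) by simp
    show "card I = card (J - {j0})"
      using insert.prems(1,2) insert.hyps j0(1) by simp
    show "a' i j \<in> smooth_functions A" if "i \<in> I" "j \<in> J - {j0}" for i j
      unfolding a'_def using that j0(1) by (intro smooth_diff smooth_mult a u(1)) auto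
    show "b' j \<in> smooth_functions A" if "j \<in> J - {j0}" for j
      unfolding b'_def using that j0(1) by (intro smooth_diff smooth_mult a b u(1)) auto
    fix v i assume v: "\<And>j. j \<in> J - {j0} \<Longrightarrow> (\<Sum>i\<in>I. v i * a' i j p) = 0" and i: "i \<in> I"
    \<comment> \<open>A kernel vector of the reduced system extends to one of the full system: its
      entry at k is determined by equation j0.\<close>
    define s where "s = (\<Sum>i\<in>I. v i * a i j0 p)"
    define w where "w i = (if i = k then - (s * u p) else v i)" for i
    have "(\<Sum>i\<in>insert k I. w i * a i j p) = 0" if j: "j \<in> J" for j
    proof -
      have "(\<Sum>i\<in>I. w i * a i j p) = (\<Sum>i\<in>I. v i * a i j p)"
        using insert.hyps(2) by (intro sum.cong) (auto simp: w_def)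
      then have sum: "(\<Sum>i\<in>insert k I. w i * a i j p) = - (s * u p) * a k j p + (\<Sum>i\<in>I. v i * a i j p)"
        using insert.hyps by (simp add: w_def)
      show ?thesis
      proof (cases "j = j0")
        case True
        then show ?thesis using sum u(4)[OF u(3)] by (simp add: s_def mult.assoc mult.commute[of "u p"])
      next
        case False
        have "(\<Sum>i\<in>I. v i * a' i j p) = (\<Sum>i\<in>I. v i * a i j p) - s * u p * a k j p"
          by (simp add: a'_def s_def right_diff_distrib sum_subtractf sum_distrib_right mult.assoc)
        then show ?thesis using v[of j] False j sum by simp
      qed
    qed
    from insert.prems(5)[of w i, OF this] i have "w i = 0" by blast
    then show "v i = 0" using i insert.hyps(2) by (auto simp: w_def split: if_splits)
  qed
  then obtain c' N' where c': "\<And>i. i \<in> I \<Longrightarrow> c' i \<in> smooth_functions A" "open N'" "p \<in> N'"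
    "\<And>q j. q \<in> N' \<Longrightarrow> j \<in> J - {j0} \<Longrightarrow> (\<Sum>i\<in>I. c' i q * a' i j q) = b' j q"
    by blast
  \<comment> \<open>Back substitution into equation j0.\<close>
  define c where "c i = (if i = k then u * (b j0 - (\<Sum>i\<in>I. c' i * a i j0)) else c' i)" for i
  have "c i \<in> smooth_functions A" if "i \<in> insert k I" for i
  proof (cases "i = k")
    case True
    have "u * (b j0 - (\<Sum>i\<in>I. c' i * a i j0)) \<in> smooth_functions A"
      using j0(1) by (intro smooth_mult smooth_diff smooth_sum u(1) b a c'(1)) auto
    then show ?thesis using True by (simp add: c_def)
  qed (use c'(1) that in \<open>auto simp: c_def\<close>)
  moreover have "(\<Sum>i\<in>insert k I. c i q * a i j q) = b j q" if q: "q \<in> N' \<inter> M" and j: "j \<in> J" for q j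
  proof -
    define s where "s = (\<Sum>i\<in>I. c' i q * a i j0 q)"
    have "(\<Sum>i\<in>I. c i q * a i j q) = (\<Sum>i\<in>I. c' i q * a i j q)"
      using insert.hyps(2) by (intro sum.cong) (auto simp: c_def)
    then have sum: "(\<Sum>i\<in>insert k I. c i q * a i j q) =
        u q * (b j0 q - s) * a k j q + (\<Sum>i\<in>I. c' i q * a i j q)"
      using insert.hyps by (simp add: c_def s_def sum_fun_apply)
    show ?thesis
    proof (cases "j = j0")
      case True
      have "u q * (b j0 q - s) * a k j0 q = (a k j0 q * u q) * (b j0 q - s)" by simp
      also have "\<dots> = b j0 q - s" using u(4)[of q] q by simp
      finally have "u q * (b j0 q - s) * a k j0 q + s = b j0 q" by linarith
      then show ?thesis using sum unfolding True s_def[symmetric] by simp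
    next
      case False
      have "(\<Sum>i\<in>I. c' i q * a' i j q) = (\<Sum>i\<in>I. c' i q * a i j q) - s * u q * a k j q"
        by (simp add: a'_def s_def right_diff_distrib sum_subtractf sum_distrib_right mult.assoc)
      then show ?thesis using c'(4)[of q j] q False j sum by (simp add: b'_def algebra_simps)
    qed
  qed
  ultimately show ?case
    using c'(2,3) u(2,3) by (intro exI[of _ c] exI[of _ "N' \<inter> M"]) auto
qed

text \<open>Real linear combinations express all entries of the block matrix, and evaluation at a
  function and a point turns their identities into real arithmetic.\<close>

definition comb :: "real \<Rightarrow> 'a vfield \<Rightarrow> real \<Rightarrow> 'a vfield \<Rightarrow> 'a vfield" where
  "comb a X b Y = fscale (\<lambda>_. a) X + fscale (\<lambda>_. b) Y"

lemma comb_apply: "comb a X b Y f p = a * X f p + b * Y f p"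
  by (simp add: comb_def fscale_def)

lemma comb_vector_field: "X \<in> vector_fields A \<Longrightarrow> Y \<in> vector_fields A \<Longrightarrow> comb a X b Y \<in> vector_fields A"
  unfolding comb_def by (intro vector_field_plus vector_field_fscale smooth_const)

lemma covector_comb:
  assumes "function_linear A fscale (vector_fields A) (*) (smooth_functions A) L"
    "X \<in> vector_fields A" "Y \<in> vector_fields A"
  shows "L (comb a X b Y) p = a * L X p + b * L Y p"
  unfolding comb_def
  using covector_add[OF assms(1) vector_field_fscale[OF smooth_const assms(2)] vector_field_fscale[OF smooth_const assms(3)]]
    covector_fscale[OF assms(1) smooth_const assms(2)] covector_fscale[OF assms(1) smooth_const assms(3)]
  by simp

lemma nonzero_vector_field: "\<exists>X\<in>vector_fields A. value_at p X \<noteq> 0"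
proof -
  obtain N x E where fr: "p \<in> N" "coordinate_frame N x E"
    using coordinate_frame_at by blast
  obtain i :: 'e where i: "i \<in> Basis" using nonempty_Basis by blast
  have "E i (x i) p = 1" using coordinate_frameD(4)[OF fr(2) i i fr(1)] by simp
  then have "value_at p (E i) (x i) \<noteq> 0" by (simp add: value_at_def)
  then have "value_at p (E i) \<noteq> 0" by (metis zero_fun_apply)
  then show ?thesis using coordinate_frameD(3)[OF fr(2)] by blast
qed

subsection \<open>1-forms\<close>

lemma one_formsI:
  assumes "\<And>X. X \<notin> vector_fields A \<Longrightarrow> \<xi> X = 0" "\<And>X. X \<in> vector_fields A \<Longrightarrow> \<xi> X \<in> smooth_functions A"
    "\<And>X Y p. X \<in> vector_fields A \<Longrightarrow> Y \<in> vector_fields A \<Longrightarrow> \<xi> (X + Y) p = \<xi> X p + \<xi> Y p"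
    "\<And>f X p. f \<in> smooth_functions A \<Longrightarrow> X \<in> vector_fields A \<Longrightarrow> \<xi> (fscale f X) p = f p * \<xi> X p"
  shows "\<xi> \<in> one_forms A"
  unfolding one_forms_def function_linear_def using assms by (auto simp: fun_eq_iff)

lemma one_form_linear:
  "\<xi> \<in> one_forms A \<Longrightarrow> function_linear A fscale (vector_fields A) (*) (smooth_functions A) \<xi>"
  unfolding one_forms_def by blast

lemma one_form_outside: "\<xi> \<in> one_forms A \<Longrightarrow> X \<notin> vector_fields A \<Longrightarrow> \<xi> X = 0"
  unfolding one_forms_def by blast

lemma one_form_zero: "0 \<in> one_forms A"
  by (rule one_formsI) (auto simp: smooth_zero)

definition differential :: "('a \<Rightarrow> real) \<Rightarrow> 'a form1" where
  "differential f = (\<lambda>X. if X \<in> vector_fields A then X f else 0)"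

lemma differential_one_form:
  assumes "f \<in> smooth_functions A"
  shows "differential f \<in> one_forms A"
proof (rule one_formsI)
  show "differential f X \<in> smooth_functions A" if "X \<in> vector_fields A" for X
    using vector_field_smooth[OF that assms] that by (simp add: differential_def)
  show "differential f (fscale h X) p = h p * differential f X p"
    if "h \<in> smooth_functions A" "X \<in> vector_fields A" for h X p
    using that vector_field_fscale[OF that] by (simp add: differential_def) (simp add: fscale_def)
qed (auto simp: differential_def vector_field_plus)

end

subsection \<open>The musical isomorphisms\<close>

lemma fscale_apply: "fscale f X x p = f p * X x p"
  by (simp add: fscale_def)

lemma gvector_vector_space: "vector_space gvector_scale"
  by unfold_locales (auto simp: gvector_scale_def algebra_simps fun_eq_iff)

text \<open>Injectivity is assumed on V only, since the space of formal vectors is much larger than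
  a fibre. A basis of V is carried to a basis of the image.\<close>

lemma dim_injective_linear_image:
  assumes "Vector_Spaces.linear s s f" "module.subspace s V" "inj_on f V"
  shows "vector_space.dim s (f ` V) = vector_space.dim s V"
proof -
  interpret Vector_Spaces.linear s s f by fact
  obtain B where B: "B \<subseteq> V" "vs1.independent B" "V \<subseteq> vs1.span B"
    using vs1.maximal_independent_subset[of V] by blast
  have sp: "vs1.span B = V"
    using B vs1.span_minimal[OF B(1) assms(2)] by blast
  have "vs1.dim V = card B"
    by (rule vs1.dim_eq_card[OF _ B(2)]) (metis sp vs1.span_span)
  moreover have "vs1.dim (f ` V) = card (f ` B)"
  proof (rule vs1.dim_eq_card)
    show "vs1.independent (f ` B)"
      using independent_injective_image[OF B(2)] assms(3) sp by simp
    show "vs1.span (f ` B) = vs1.span (f ` V)"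
      by (metis span_image sp vs1.span_span)
  qed
  moreover have "card (f ` B) = card B"
    using assms(3) B(1) by (intro card_image) (rule inj_on_subset)
  ultimately show ?thesis by simp
qed

locale metric_bundle = manifold A
  for A :: "('a::{t2_space, second_countable_topology}, 'e::euclidean_space) atlas" +
  fixes g :: "'a vfield \<Rightarrow> 'a vfield \<Rightarrow> 'a \<Rightarrow> real"
  assumes metric: "bundle_metric A fscale value_at (vector_fields A) g"
begin

lemma metric_sym: "X \<in> vector_fields A \<Longrightarrow> Y \<in> vector_fields A \<Longrightarrow> g X Y = g Y X"
  using metric unfolding bundle_metric_def by blast

lemma metric_linear_right:
  "X \<in> vector_fields A \<Longrightarrow> function_linear A fscale (vector_fields A) (*) (smooth_functions A) (g X)"
  using metric unfolding bundle_metric_def by blast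

lemma metric_linear_left:
  assumes Y: "Y \<in> vector_fields A"
  shows "function_linear A fscale (vector_fields A) (*) (smooth_functions A) (\<lambda>X. g X Y)"
  unfolding function_linear_def
proof (intro conjI ballI)
  fix X assume X: "X \<in> vector_fields A"
  show "g X Y \<in> smooth_functions A"
    using covector_smooth[OF metric_linear_right[OF X] Y] .
  show "g (X + Z) Y = g X Y + g Z Y" if Z: "Z \<in> vector_fields A" for Z
    using covector_add[OF metric_linear_right[OF Y] X Z]
      metric_sym[OF X Y] metric_sym[OF Z Y] metric_sym[OF vector_field_plus[OF X Z] Y] by metis
  show "g (fscale f X) Y = f * g X Y" if f: "f \<in> smooth_functions A" for f
    using covector_fscale[OF metric_linear_right[OF Y] f X]
      metric_sym[OF X Y] metric_sym[OF vector_field_fscale[OF f X] Y] by metis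
qed

lemma metric_comb:
  assumes "X \<in> vector_fields A" "Y \<in> vector_fields A" "Z \<in> vector_fields A"
  shows "g (comb a X b Y) Z p = a * g X Z p + b * g Y Z p"
    and "g Z (comb a X b Y) p = a * g Z X p + b * g Z Y p"
  using covector_comb[OF metric_linear_left[OF assms(3)] assms(1,2)]
    covector_comb[OF metric_linear_right[OF assms(3)] assms(1,2)] by simp_all

lemma metric_nondegenerate:
  assumes "X \<in> vector_fields A" "\<And>Y. Y \<in> vector_fields A \<Longrightarrow> g X Y p = 0"
  shows "X f p = 0"
proof -
  have "value_at p X = 0" using metric assms unfolding bundle_metric_def by blast
  then show ?thesis by (metis value_at_def zero_fun_apply)
qed

lemma metric_determines:
  assumes "X \<in> vector_fields A" "Y \<in> vector_fields A" "\<And>Z. Z \<in> vector_fields A \<Longrightarrow> g X Z p = g Y Z p"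
  shows "X f p = Y f p"
  using metric_nondegenerate[OF comb_vector_field[OF assms(1,2)], of 1 "- 1" p f] assms
  by (simp add: metric_comb comb_apply)

text \<open>Provides the nonzero pairing from which the sign \<epsilon> can be read off.\<close>

lemma metric_nonzero: "\<exists>X\<in>vector_fields A. \<exists>Y\<in>vector_fields A. g X Y p \<noteq> 0"
proof -
  obtain X where X: "X \<in> vector_fields A" "value_at p X \<noteq> 0" using nonzero_vector_field by blast
  then have "\<exists>Y\<in>vector_fields A. g X Y p \<noteq> 0" using metric unfolding bundle_metric_def by blast
  then show ?thesis using X(1) by blast
qed

lemma flat_apply: "Y \<in> vector_fields A \<Longrightarrow> flat A g X Y = g X Y"
  by (simp add: flat_def)

lemma flat_one_form:
  assumes X: "X \<in> vector_fields A"
  shows "flat A g X \<in> one_forms A"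
proof (rule one_formsI)
  note L = metric_linear_right[OF X]
  show "flat A g X Y = 0" if "Y \<notin> vector_fields A" for Y using that by (simp add: flat_def)
  show "flat A g X Y \<in> smooth_functions A" if "Y \<in> vector_fields A" for Y
    using covector_smooth[OF L that] flat_apply[OF that] by simp
  show "flat A g X (Y + Z) p = flat A g X Y p + flat A g X Z p"
    if "Y \<in> vector_fields A" "Z \<in> vector_fields A" for Y Z p
    using covector_add[OF L that] that by (simp add: flat_apply vector_field_plus)
  show "flat A g X (fscale f Y) p = f p * flat A g X Y p"
    if "f \<in> smooth_functions A" "Y \<in> vector_fields A" for f Y p
    using covector_fscale[OF L that] that by (simp add: flat_apply vector_field_fscale)
qed

lemma flat_inj: "inj_on (flat A g) (vector_fields A)"
proof (rule inj_onI, intro ext)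
  fix X Y f p assume XY: "X \<in> vector_fields A" "Y \<in> vector_fields A" "flat A g X = flat A g Y"
  show "X f p = Y f p"
    by (rule metric_determines[OF XY(1,2)]) (use XY(3) flat_apply in metis)
qed

lemma local_sharp:
  assumes \<xi>: "\<xi> \<in> one_forms A"
  shows "\<exists>X\<in>vector_fields A. \<exists>N. open N \<and> p \<in> N \<and> (\<forall>Y\<in>vector_fields A. \<forall>q\<in>N. g X Y q = \<xi> Y q)"
proof -
  obtain N x E where fr: "p \<in> N" "coordinate_frame N x E"
    using coordinate_frame_at by blast
  note frD = coordinate_frameD[OF fr(2)]
  have "\<exists>c M. (\<forall>i\<in>Basis. c i \<in> smooth_functions A) \<and> open M \<and> p \<in> M \<and>
    (\<forall>q\<in>M. \<forall>j\<in>Basis. (\<Sum>i\<in>Basis. c i q * g (E i) (E j) q) = \<xi> (E j) q)"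
  proof (rule local_linear_solve)
    show "finite (Basis :: 'e set)" "finite (Basis :: 'e set)" "card (Basis :: 'e set) = card (Basis :: 'e set)"
      by auto
    show "g (E i) (E j) \<in> smooth_functions A" for i j
      by (rule covector_smooth[OF metric_linear_right[OF frD(3)] frD(3)])
    show "\<xi> (E j) \<in> smooth_functions A" for j
      by (rule covector_smooth[OF one_form_linear[OF \<xi>] frD(3)])
    fix v :: "'e \<Rightarrow> real" and k :: 'e
    assume v: "\<And>j. j \<in> Basis \<Longrightarrow> (\<Sum>i\<in>Basis. v i * g (E i) (E j) p) = 0" and k: "k \<in> Basis"
    define X where "X = (\<Sum>i\<in>Basis. fscale (\<lambda>_. v i) (E i))"
    have vf: "fscale (\<lambda>_. v i) (E i) \<in> vector_fields A" for i
      by (rule vector_field_fscale[OF smooth_const frD(3)])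
    then have X: "X \<in> vector_fields A" unfolding X_def by (rule vector_field_Sum)
    have gX: "g X Y p = (\<Sum>i\<in>Basis. v i * g (E i) Y p)" if Y: "Y \<in> vector_fields A" for Y
    proof -
      have "g X Y = (\<Sum>i\<in>Basis. g (fscale (\<lambda>_. v i) (E i)) Y)"
        unfolding X_def by (rule covector_sum[OF metric_linear_left[OF Y]]) (rule vf)
      then show ?thesis
        using covector_fscale[OF metric_linear_left[OF Y] smooth_const frD(3)] by (simp add: sum_fun_apply)
    qed
    have "g X Y p = 0" if Y: "Y \<in> vector_fields A" for Y
      using covector_frame[OF metric_linear_right[OF X] fr(2) Y fr(1)] gX[OF frD(3)] v by simp
    then have "X (x k) p = 0" by (rule metric_nondegenerate[OF X])
    moreover have "X (x k) p = (\<Sum>i\<in>Basis. v i * E i (x k) p)"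
      by (simp add: X_def sum_fun_apply fscale_def)
    moreover have "\<dots> = (\<Sum>i\<in>Basis. if i = k then v i else 0)"
      by (rule sum.cong) (use frD(4) k fr(1) in auto)
    ultimately show "v k = 0" using k by simp
  qed
  then obtain c M where c: "\<And>i. i \<in> Basis \<Longrightarrow> c i \<in> smooth_functions A" "open M" "p \<in> M"
    "\<And>q j. q \<in> M \<Longrightarrow> j \<in> Basis \<Longrightarrow> (\<Sum>i\<in>Basis. c i q * g (E i) (E j) q) = \<xi> (E j) q"
    by blast
  define X where "X = (\<Sum>i\<in>Basis. fscale (c i) (E i))"
  have vf: "fscale (c i) (E i) \<in> vector_fields A" if "i \<in> Basis" for i
    by (rule vector_field_fscale[OF c(1)[OF that] frD(3)])
  then have X: "X \<in> vector_fields A" unfolding X_def by (rule vector_field_Sum)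
  have gX: "g X (E j) q = (\<Sum>i\<in>Basis. c i q * g (E i) (E j) q)" for j q
  proof -
    have "g X (E j) = (\<Sum>i\<in>Basis. g (fscale (c i) (E i)) (E j))"
      unfolding X_def by (rule covector_sum[OF metric_linear_left[OF frD(3)]]) (rule vf)
    then show ?thesis
      using covector_fscale[OF metric_linear_left[OF frD(3)] c(1) frD(3)] by (simp add: sum_fun_apply)
  qed
  have "g X Y q = \<xi> Y q" if Y: "Y \<in> vector_fields A" and q: "q \<in> N \<inter> M" for Y q
    using covector_frame[OF metric_linear_right[OF X] fr(2) Y, of q] gX c(4)[of q]
      covector_frame[OF one_form_linear[OF \<xi>] fr(2) Y, of q] q by simp
  then show ?thesis
    using X fr(1) frD(1) c(2,3) by (intro bexI[of _ X] exI[of _ "N \<inter> M"]) auto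
qed

lemma flat_surj:
  assumes \<xi>: "\<xi> \<in> one_forms A"
  shows "\<exists>X\<in>vector_fields A. flat A g X = \<xi>"
proof -
  obtain X N where X: "\<And>p. X p \<in> vector_fields A" "\<And>p. open (N p)" "\<And>p. p \<in> N p"
    "\<And>p Y q. Y \<in> vector_fields A \<Longrightarrow> q \<in> N p \<Longrightarrow> g (X p) Y q = \<xi> Y q"
    using local_sharp[OF \<xi>] by metis
  \<comment> \<open>Gluing along the diagonal: at q the solution chosen for q itself is used.
    Fibrewise uniqueness identifies it with the solution chosen for any p whose neighbourhood
    contains q.\<close>
  define Z where "Z f q = X q f q" for f q
  have Z: "Z f q = X p f q" if "q \<in> N p" for f p q
    unfolding Z_def by (rule metric_determines[OF X(1) X(1)]) (simp add: X(3,4) that)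
  have vf: "Z \<in> vector_fields A"
  proof (rule vector_fieldsI)
    show "Z f \<in> smooth_functions A" if "f \<in> smooth_functions A" for f
    proof (rule smooth_functions_locally)
      show "\<exists>h\<in>smooth_functions A. \<exists>W. open W \<and> p \<in> W \<and> (\<forall>q\<in>W. Z f q = h q)" for p
        by (intro bexI[of _ "X p f"] exI[of _ "N p"] conjI ballI X(2,3) Z vector_field_smooth[OF X(1) that])
    qed
  \<comment> \<open>The derivation laws at q are those of the single field X q; only smoothness
    needs agreement with a fixed field on a neighbourhood.\<close>
  qed (simp_all add: Z_def vector_field_outside[OF X(1)] vector_field_add[OF X(1)]
      vector_field_cmult[OF X(1)] vector_field_mult[OF X(1)])
  moreover have "flat A g Z Y q = \<xi> Y q" for Y q
  proof (cases "Y \<in> vector_fields A")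
    case True
    have "g Z Y q = g (X q) Y q"
      by (rule covector_local[OF metric_linear_left[OF True] vf X(1) X(2) X(3)]) (rule Z)
    then show ?thesis using X(4)[OF True X(3)] True by (simp add: flat_apply)
  next
    case False
    then show ?thesis using one_form_outside[OF \<xi>] by (simp add: flat_def)
  qed
  ultimately show ?thesis by (intro bexI[of _ Z]) auto
qed

lemma flat_image: "flat A g ` vector_fields A = one_forms A"
  using flat_one_form flat_surj by blast

lemma sharp_flat: "X \<in> vector_fields A \<Longrightarrow> sharp A g (flat A g X) = X"
  unfolding sharp_def using flat_inj by simp

lemma sharp_vector_field: "\<xi> \<in> one_forms A \<Longrightarrow> sharp A g \<xi> \<in> vector_fields A"
  unfolding sharp_def using flat_image by (simp add: inv_into_into)

lemma flat_sharp: "\<xi> \<in> one_forms A \<Longrightarrow> flat A g (sharp A g \<xi>) = \<xi>"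
  unfolding sharp_def using flat_image by (simp add: f_inv_into_f)

subsection \<open>Sections of the generalized tangent bundle\<close>

text \<open>Writing the form part as \<flat>Z turns every later identity between sections into an
  identity between vector fields.\<close>

lemma gsections_cases:
  assumes "u \<in> gsections A"
  obtains X Z where "X \<in> vector_fields A" "Z \<in> vector_fields A" "u = (X, flat A g Z)"
proof -
  obtain X \<xi> where u: "u = (X, \<xi>)" "X \<in> vector_fields A" "\<xi> \<in> one_forms A"
    using assms by (auto simp: gsections_def)
  show thesis
    by (rule that[of X "sharp A g \<xi>"]) (simp_all add: u sharp_vector_field flat_sharp)
qed

lemma gsections_flat: "X \<in> vector_fields A \<Longrightarrow> Z \<in> vector_fields A \<Longrightarrow> (X, flat A g Z) \<in> gsections A"
  by (simp add: gsections_def flat_one_form)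

lemma flat_add:
  assumes "X \<in> vector_fields A" "Y \<in> vector_fields A"
  shows "flat A g (X + Y) = flat A g X + flat A g Y"
  using covector_add[OF metric_linear_left assms] by (auto simp: flat_def fun_eq_iff)

lemma flat_fscale:
  assumes "f \<in> smooth_functions A" "X \<in> vector_fields A"
  shows "flat A g (fscale f X) = fscale f (flat A g X)"
  using covector_fscale[OF metric_linear_left assms] by (auto simp: flat_def fscale_def fun_eq_iff)

lemma gsections_add: "u \<in> gsections A \<Longrightarrow> v \<in> gsections A \<Longrightarrow> u + v \<in> gsections A"
  by (elim gsections_cases) (simp add: flat_add[symmetric] gsections_flat vector_field_plus)

lemma gsections_scale: "f \<in> smooth_functions A \<Longrightarrow> u \<in> gsections A \<Longrightarrow> gscale f u \<in> gsections A"
  by (elim gsections_cases) (simp add: gscale_def flat_fscale[symmetric] gsections_flat vector_field_fscale)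

lemma natural_metric_flat:
  "X \<in> vector_fields A \<Longrightarrow> Y \<in> vector_fields A \<Longrightarrow>
    natural_metric (X, flat A g Z) (Y, flat A g W) p = (g Z Y p + g W X p) / 2"
  by (simp add: natural_metric_def flat_apply)

lemma natural_metric_bundle_metric: "bundle_metric A gscale gvalue_at (gsections A) natural_metric"
  unfolding bundle_metric_def
proof (intro conjI ballI allI impI)
  fix u assume u: "u \<in> gsections A"
  then have u1: "fst u \<in> vector_fields A" and u2: "snd u \<in> one_forms A"
    by (auto simp: gsections_def)
  note L = one_form_linear[OF u2]
  show "function_linear A gscale (gsections A) (*) (smooth_functions A) (natural_metric u)"
    unfolding function_linear_def
  proof (intro conjI ballI)
    fix v assume "v \<in> gsections A"
    then have v1: "fst v \<in> vector_fields A" and v2: "snd v \<in> one_forms A"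
      by (auto simp: gsections_def)
    have "(\<lambda>p. 1 / 2 * (snd u (fst v) + snd v (fst u)) p) \<in> smooth_functions A"
      by (intro smooth_cmult smooth_add covector_smooth[OF L v1] covector_smooth[OF one_form_linear[OF v2] u1])
    then show "natural_metric u v \<in> smooth_functions A"
      by (simp add: natural_metric_def)
    show "natural_metric u (v + w) = natural_metric u v + natural_metric u w" if "w \<in> gsections A" for w
    proof
      fix p
      have "fst w \<in> vector_fields A" using that by (auto simp: gsections_def)
      from covector_add[OF L v1 this]
      show "natural_metric u (v + w) p = (natural_metric u v + natural_metric u w) p"
        by (simp add: natural_metric_def algebra_simps add_divide_distrib)
    qed
    show "natural_metric u (gscale f v) = f * natural_metric u v" if "f \<in> smooth_functions A" for f
      using covector_fscale[OF L that v1]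
      by (auto simp: natural_metric_def gscale_def fscale_apply algebra_simps)
  qed
  show "natural_metric u v = natural_metric v u" for v
    by (simp add: natural_metric_def add.commute)
  fix p assume 0: "\<forall>v\<in>gsections A. natural_metric u v p = 0"
  \<comment> \<open>Nondegeneracy: pairing with (Y, 0) detects the covector part, and pairing with
    (0, df) detects the tangent part.\<close>
  have "snd u Y p = 0" for Y
  proof (cases "Y \<in> vector_fields A")
    case True
    then have "(Y, 0) \<in> gsections A" using one_form_zero by (simp add: gsections_def)
    then show ?thesis using 0 by (force simp: natural_metric_def)
  qed (use one_form_outside[OF u2] in simp)
  moreover have "fst u f p = 0" for f
  proof (cases "f \<in> smooth_functions A")
    case True
    then have "(0, differential f) \<in> gsections A"
      using differential_one_form vector_field_zero by (simp add: gsections_def)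
    then have "natural_metric u (0, differential f) p = 0" using 0 by blast
    then show ?thesis
      using u1 covector_zero[OF L] by (simp add: natural_metric_def differential_def)
  qed (use vector_field_outside[OF u1] in simp)
  ultimately show "gvalue_at p u = 0"
    by (simp add: gvalue_at_def value_at_def zero_prod_def zero_fun_def)
qed

text \<open>The subbundle TM is isotropic and nonzero.\<close>

lemma natural_metric_not_positive_definite: "\<not> positive_definite gvalue_at (gsections A) natural_metric"
proof
  fix p :: 'a
  assume pd: "positive_definite gvalue_at (gsections A) natural_metric"
  obtain X where X: "X \<in> vector_fields A" "value_at p X \<noteq> 0" using nonzero_vector_field by blast
  have "(X, 0) \<in> gsections A" using X one_form_zero by (simp add: gsections_def)
  moreover have "gvalue_at p (X, 0) \<noteq> 0" using X(2) by (simp add: gvalue_at_def zero_prod_def)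
  ultimately have "natural_metric (X, 0) (X, 0) p > 0" using pd unfolding positive_definite_def by blast
  then show False by (simp add: natural_metric_def)
qed

section \<open>The rotation and the ranks of the eigenbundles\<close>

definition rotation :: "'a gsection \<Rightarrow> 'a gsection" where
  "rotation u = (sharp A g (snd u), fscale (\<lambda>_. - 1) (flat A g (fst u)))"

lemma rotation_flat:
  "X \<in> vector_fields A \<Longrightarrow> Z \<in> vector_fields A \<Longrightarrow>
    rotation (X, flat A g Z) = (Z, flat A g (fscale (\<lambda>_. - 1) X))"
  by (simp add: rotation_def sharp_flat flat_fscale smooth_const)

lemma rotation_gsections: "u \<in> gsections A \<Longrightarrow> rotation u \<in> gsections A"
  by (elim gsections_cases) (simp add: rotation_flat gsections_flat vector_field_fscale smooth_const)

lemma gscale_flat: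
  "X \<in> vector_fields A \<Longrightarrow> Z \<in> vector_fields A \<Longrightarrow>
    gscale (\<lambda>_. c) (X, flat A g Z) = (fscale (\<lambda>_. c) X, flat A g (fscale (\<lambda>_. c) Z))"
  by (simp add: gscale_def flat_fscale smooth_const)

lemma fscale_fscale: "fscale (\<lambda>_. c) (fscale (\<lambda>_. d) X) = fscale (\<lambda>_. c * d) X"
  by (simp add: fscale_def fun_eq_iff)

lemma rotation_gscale:
  "u \<in> gsections A \<Longrightarrow> rotation (gscale (\<lambda>_. c) u) = gscale (\<lambda>_. c) (rotation u)"
  by (elim gsections_cases)
    (simp add: rotation_flat gscale_flat vector_field_fscale smooth_const fscale_fscale mult.commute)

lemma rotation_rotation: "u \<in> gsections A \<Longrightarrow> rotation (rotation u) = gscale (\<lambda>_. - 1) u"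
  by (elim gsections_cases) (simp add: rotation_flat gscale_flat vector_field_fscale smooth_const)

text \<open>Both sides are g(\<sharp>\<xi>, \<sharp>df); symmetry of g moves \<sharp> from \<xi> to
  df.\<close>

lemma sharp_apply:
  assumes "\<xi> \<in> one_forms A" "f \<in> smooth_functions A"
  shows "sharp A g \<xi> f = \<xi> (sharp A g (differential f))"
proof -
  note d = differential_one_form[OF assms(2)]
  note vf = sharp_vector_field[OF assms(1)] sharp_vector_field[OF d]
  have "\<xi> (sharp A g (differential f)) = g (sharp A g \<xi>) (sharp A g (differential f))"
    using flat_apply[OF vf(2)] flat_sharp[OF assms(1)] by metis
  also have "\<dots> = differential f (sharp A g \<xi>)"
    using flat_apply[OF vf(1)] flat_sharp[OF d] metric_sym[OF vf] by metis
  finally show ?thesis using vf(1) by (simp add: differential_def)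
qed

text \<open>
  \<open>R\<close> acts on all formal vectors, also those that are not values of sections. It comes from
  \<open>(\<sharp>\<xi>)(f) = \<xi>(\<sharp>df)\<close> and \<open>\<flat>X = \<Sum> X(x\<^sub>i) \<flat>E\<^sub>i\<close>, whose right-hand sides make sense there.
\<close>

lemma rotation_at:
  "\<exists>R. Vector_Spaces.linear gvector_scale gvector_scale R \<and>
    (\<forall>u\<in>gsections A. R (gvalue_at p u) = gvalue_at p (rotation u))"
proof -
  obtain N x E where fr: "p \<in> N" "coordinate_frame N x E"
    using coordinate_frame_at by blast
  define R :: "'a gvector \<Rightarrow> 'a gvector" where
    "R w = (\<lambda>f. if f \<in> smooth_functions A then snd w (sharp A g (differential f)) else 0,
      \<lambda>Y. if Y \<in> vector_fields A then - (\<Sum>i\<in>Basis. fst w (x i) * g (E i) Y p) else 0)" for w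
  interpret vector_space "gvector_scale :: real \<Rightarrow> 'a gvector \<Rightarrow> 'a gvector"
    by (rule gvector_vector_space)
  have "Vector_Spaces.linear gvector_scale gvector_scale R"
    by unfold_locales
      (auto simp: R_def gvector_scale_def fun_eq_iff sum.distrib sum_distrib_left algebra_simps)
  moreover have "R (gvalue_at p u) = gvalue_at p (rotation u)" if "u \<in> gsections A" for u
  proof -
    have u: "fst u \<in> vector_fields A" "snd u \<in> one_forms A" using that by (auto simp: gsections_def)
    show ?thesis
    proof (intro prod_eqI ext)
      show "fst (R (gvalue_at p u)) f = fst (gvalue_at p (rotation u)) f" for f
        using sharp_apply[OF u(2)] vector_field_outside[OF sharp_vector_field[OF u(2)]]
        by (simp add: R_def gvalue_at_def value_at_def rotation_def)
      show "snd (R (gvalue_at p u)) Y = snd (gvalue_at p (rotation u)) Y" for Y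
      proof (cases "Y \<in> vector_fields A")
        case True
        then show ?thesis
          using covector_frame[OF metric_linear_left[OF True] fr(2) u(1) fr(1)]
          by (simp add: R_def gvalue_at_def value_at_def rotation_def fscale_apply flat_apply)
      next
        case False
        then show ?thesis
          by (simp add: R_def gvalue_at_def value_at_def rotation_def fscale_apply flat_def)
      qed
    qed
  qed
  ultimately show ?thesis by blast
qed

text \<open>A fibre of an eigenbundle consists of values of sections that satisfy the eigenvalue
  equation globally. The rotation therefore acts on sections first, and R carries the action to the
  values at p.\<close>

lemma eigenbundle_fibre_dim:
  assumes lin: "function_linear A gscale (gsections A) gscale (gsections A) F"
    and anti: "\<And>u. u \<in> gsections A \<Longrightarrow> F (rotation u) = gscale (\<lambda>_. - 1) (rotation (F u))"
  shows "vector_space.dim gvector_scale (eigenbundle_fibre A F (- c) p) =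
    vector_space.dim gvector_scale (eigenbundle_fibre A F c p)"
proof -
  interpret V: vector_space "gvector_scale :: real \<Rightarrow> 'a gvector \<Rightarrow> 'a gvector"
    by (rule gvector_vector_space)
  obtain R where R: "Vector_Spaces.linear gvector_scale gvector_scale R"
    "\<And>u. u \<in> gsections A \<Longrightarrow> R (gvalue_at p u) = gvalue_at p (rotation u)"
    using rotation_at by blast
  have gg: "gscale (\<lambda>_. a) (gscale (\<lambda>_. b) u) = gscale (\<lambda>_. a * b) u" for a b :: real and u :: "'a gsection"
    by (simp add: gscale_def fscale_fscale)
  have val: "gvalue_at p (gscale (\<lambda>_. a) u) = gvector_scale a (gvalue_at p u)"
    "gvalue_at p (u + v) = gvalue_at p u + gvalue_at p v" for a :: real and u v :: "'a gsection"
    by (auto simp: gvalue_at_def gscale_def gvector_scale_def value_at_def fscale_apply fun_eq_iff)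
  have Fs: "F (gscale (\<lambda>_. a) u) = gscale (\<lambda>_. a) (F u)" if "u \<in> gsections A" for a u
    using lin smooth_const that unfolding function_linear_def by blast
  define S where "S c = {u \<in> gsections A. F u = gscale (\<lambda>_. c) u}" for c
  have S_scale: "gscale (\<lambda>_. a) u \<in> S c" if "u \<in> S c" for a c u
    using that gsections_scale[OF smooth_const] Fs by (auto simp: S_def gg mult.commute)
  have S_rot: "rotation u \<in> S (- c)" if "u \<in> S c" for c u
    using that rotation_gsections anti rotation_gscale by (auto simp: S_def gg)
  have fib: "eigenbundle_fibre A F c p = gvalue_at p ` S c" for c
    by (simp add: eigenbundle_fibre_def S_def)
  have sub: "V.subspace (gvalue_at p ` S c)"
  proof (rule V.subspaceI)
    have 0: "(0, 0) \<in> gsections A" by (simp add: gsections_def vector_field_zero one_form_zero)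
    have z: "gscale (\<lambda>_. 0) u = (0, 0)" "gscale (\<lambda>_. c) (0, 0) = (0, 0 :: 'a form1)" for u :: "'a gsection"
      by (auto simp: gscale_def fscale_def fun_eq_iff)
    have "F (0, 0) = (0, 0)" using Fs[OF 0, of 0] unfolding z .
    then have "(0, 0) \<in> S c" by (simp add: S_def z 0)
    moreover have "gvalue_at p (0, 0) = 0" by (simp add: gvalue_at_def value_at_def fun_eq_iff zero_prod_def)
    ultimately show "0 \<in> gvalue_at p ` S c" by (metis imageI)
  next
    fix v w assume "v \<in> gvalue_at p ` S c" "w \<in> gvalue_at p ` S c"
    then obtain s t where st: "s \<in> S c" "t \<in> S c" "v = gvalue_at p s" "w = gvalue_at p t" by blast
    have "F (s + t) = F s + F t"
      using lin st unfolding function_linear_def S_def by blast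
    then have "s + t \<in> S c"
      using st gsections_add by (auto simp: S_def gscale_def fscale_def fun_eq_iff algebra_simps)
    then show "v + w \<in> gvalue_at p ` S c" using st val(2) by (metis imageI)
  next
    fix a v assume "v \<in> gvalue_at p ` S c"
    then show "gvector_scale a v \<in> gvalue_at p ` S c" using S_scale val(1) by (metis (no_types, lifting) imageE imageI)
  qed
  \<comment> \<open>On values of sections R squares to -1, so -R is a left inverse.\<close>
  have inj: "inj_on R (gvalue_at p ` S c)"
  proof (rule inj_on_inverseI)
    fix v assume "v \<in> gvalue_at p ` S c"
    then obtain u where u: "u \<in> gsections A" "v = gvalue_at p u" by (auto simp: S_def)
    have "R (R v) = gvector_scale (- 1) v"
      using u R(2) rotation_gsections rotation_rotation val(1) by simp
    then show "gvector_scale (- 1) (R (R v)) = v" by (simp add: gvector_scale_def)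
  qed
  have "R ` gvalue_at p ` S c = gvalue_at p ` S (- c)"
  proof (intro subset_antisym subsetI)
    fix w assume "w \<in> R ` gvalue_at p ` S c"
    then obtain u where u: "u \<in> S c" "w = R (gvalue_at p u)" by blast
    then have "w = gvalue_at p (rotation u)" using R(2) by (simp add: S_def)
    then show "w \<in> gvalue_at p ` S (- c)" using S_rot[OF u(1)] by blast
  next
    fix w assume "w \<in> gvalue_at p ` S (- c)"
    then obtain u where u: "u \<in> S (- c)" "w = gvalue_at p u" by blast
    \<comment> \<open>The rotation squares to -1, so the preimage of u is minus its
      rotation.\<close>
    define s where "s = gscale (\<lambda>_. - 1) (rotation u)"
    have s: "s \<in> S c" using S_scale[OF S_rot[OF u(1)]] by (simp add: s_def)
    have ug: "u \<in> gsections A" using u(1) by (simp add: S_def)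
    have "rotation s = gscale (\<lambda>_. 1) u"
      using rotation_gscale[OF rotation_gsections[OF ug]] rotation_rotation[OF ug]
      by (simp add: s_def gg)
    also have "\<dots> = u" by (simp add: gscale_def fscale_def prod_eq_iff fun_eq_iff)
    finally have "rotation s = u" .
    then have "w = R (gvalue_at p s)" using R(2) s u(2) by (simp add: S_def)
    then show "w \<in> R ` gvalue_at p ` S c" using s by blast
  qed
  then show ?thesis
    using dim_injective_linear_image[OF R(1) sub inj] by (simp add: fib)
qed

end

subsection \<open>Almost complex structures\<close>

locale almost_complex_metric = metric_bundle A g
  for A :: "('a::{t2_space, second_countable_topology}, 'e::euclidean_space) atlas"
    and g :: "'a vfield \<Rightarrow> 'a vfield \<Rightarrow> 'a \<Rightarrow> real" +
  fixes J :: "'a vfield \<Rightarrow> 'a vfield" and \<epsilon> :: real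
  assumes \<epsilon>: "\<epsilon> = 1 \<or> \<epsilon> = - 1"
    and J_linear: "function_linear A fscale (vector_fields A) fscale (vector_fields A) J"
    and J_J: "X \<in> vector_fields A \<Longrightarrow> J (J X) = fscale (\<lambda>_. - 1) X"
    and metric_J_J: "X \<in> vector_fields A \<Longrightarrow> Y \<in> vector_fields A \<Longrightarrow> g (J X) (J Y) = (\<lambda>p. \<epsilon> * g X Y p)"
begin

lemma J_vector_field: "X \<in> vector_fields A \<Longrightarrow> J X \<in> vector_fields A"
  and J_add: "X \<in> vector_fields A \<Longrightarrow> Y \<in> vector_fields A \<Longrightarrow> J (X + Y) = J X + J Y"
  and J_fscale: "f \<in> smooth_functions A \<Longrightarrow> X \<in> vector_fields A \<Longrightarrow> J (fscale f X) = fscale f (J X)"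
  using J_linear unfolding function_linear_def by blast+

lemma J_comb:
  assumes "X \<in> vector_fields A" "Y \<in> vector_fields A"
  shows "J (comb a X b Y) = comb a (J X) b (J Y)"
  using J_add[OF vector_field_fscale[OF smooth_const assms(1)] vector_field_fscale[OF smooth_const assms(2)]]
    J_fscale[OF smooth_const assms(1)] J_fscale[OF smooth_const assms(2)] by (simp add: comb_def)

text \<open>Put J Y for Y in the compatibility of g with J and use that J squares to -1. Evaluated
  on fields, this is the relation between \<open>J\<^sup>*\<close> and \<flat>.\<close>

lemma metric_J_left:
  assumes "X \<in> vector_fields A" "Y \<in> vector_fields A"
  shows "g (J X) Y p = - \<epsilon> * g X (J Y) p"
proof -
  have "g (J X) (J (J Y)) p = \<epsilon> * g X (J Y) p"
    using metric_J_J[OF assms(1) J_vector_field[OF assms(2)]] by simp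
  moreover have "g (J X) (J (J Y)) p = - g (J X) Y p"
    using covector_fscale[OF metric_linear_right[OF J_vector_field[OF assms(1)]] smooth_const assms(2)]
    by (simp add: J_J assms(2))
  ultimately show ?thesis by simp
qed

text \<open>Moving J through \<flat> produces a second factor -\<epsilon> beside the one in the
  lower right block; since \<epsilon> squares to 1, that block becomes -J for both signs.\<close>

lemma F_Jg_flat:
  assumes X: "X \<in> vector_fields A" and Z: "Z \<in> vector_fields A"
  shows "F_Jg A \<epsilon> J g (X, flat A g Z) = (comb 1 (J X) (sqrt 2) Z, flat A g (comb (sqrt 2) X (- 1) (J Z)))"
proof (intro prod_eqI ext)
  show "fst (F_Jg A \<epsilon> J g (X, flat A g Z)) f p =
      fst (comb 1 (J X) (sqrt 2) Z, flat A g (comb (sqrt 2) X (- 1) (J Z))) f p" for f p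
    by (simp add: F_Jg_def gmatrix_def comb_apply fscale_apply sharp_flat Z)
  show "snd (F_Jg A \<epsilon> J g (X, flat A g Z)) Y p =
      snd (comb 1 (J X) (sqrt 2) Z, flat A g (comb (sqrt 2) X (- 1) (J Z))) Y p" for Y p
  proof (cases "Y \<in> vector_fields A")
    case True
    have "\<epsilon> * \<epsilon> = 1" using \<epsilon> by auto
    then show ?thesis
      using metric_J_left[OF Z True, of p] True
      by (simp add: F_Jg_def gmatrix_def fscale_apply flat_apply dual_endo_def J_vector_field
          metric_comb X Z mult.assoc[symmetric])
  next
    case False
    then show ?thesis by (simp add: F_Jg_def gmatrix_def fscale_apply flat_def dual_endo_def)
  qed
qed

lemmas vector_field_closure = comb_vector_field J_vector_field vector_field_plus vector_field_fscale smooth_const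

lemma F_Jg_linear: "function_linear A gscale (gsections A) gscale (gsections A) (F_Jg A \<epsilon> J g)"
  unfolding function_linear_def
proof (intro conjI ballI)
  fix u assume "u \<in> gsections A"
  then obtain X Z where u: "X \<in> vector_fields A" "Z \<in> vector_fields A" "u = (X, flat A g Z)"
    by (rule gsections_cases)
  show "F_Jg A \<epsilon> J g u \<in> gsections A"
    using u by (simp add: F_Jg_flat gsections_flat vector_field_closure)
  show "F_Jg A \<epsilon> J g (u + v) = F_Jg A \<epsilon> J g u + F_Jg A \<epsilon> J g v" if "v \<in> gsections A" for v
  proof -
    obtain Y W where v: "Y \<in> vector_fields A" "W \<in> vector_fields A" "v = (Y, flat A g W)"
      using \<open>v \<in> gsections A\<close> by (rule gsections_cases)
    have "comb 1 (J (X + Y)) (sqrt 2) (Z + W) = comb 1 (J X) (sqrt 2) Z + comb 1 (J Y) (sqrt 2) W"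
      "comb (sqrt 2) (X + Y) (- 1) (J (Z + W)) = comb (sqrt 2) X (- 1) (J Z) + comb (sqrt 2) Y (- 1) (J W)"
      using u v by (auto simp: J_add fun_eq_iff comb_apply algebra_simps)
    then show ?thesis
      using u v by (simp add: F_Jg_flat flat_add[symmetric] vector_field_closure)
  qed
  show "F_Jg A \<epsilon> J g (gscale f u) = gscale f (F_Jg A \<epsilon> J g u)" if f: "f \<in> smooth_functions A" for f
  proof -
    have "comb 1 (J (fscale f X)) (sqrt 2) (fscale f Z) = fscale f (comb 1 (J X) (sqrt 2) Z)"
      "comb (sqrt 2) (fscale f X) (- 1) (J (fscale f Z)) = fscale f (comb (sqrt 2) X (- 1) (J Z))"
      using u f by (auto simp: J_fscale fun_eq_iff comb_apply fscale_apply algebra_simps)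
    then show ?thesis
      using u f by (simp add: gscale_def flat_fscale[symmetric] F_Jg_flat vector_field_closure)
  qed
qed

lemma F_Jg_involution:
  assumes "u \<in> gsections A"
  shows "F_Jg A \<epsilon> J g (F_Jg A \<epsilon> J g u) = u"
proof -
  obtain X Z where u: "X \<in> vector_fields A" "Z \<in> vector_fields A" "u = (X, flat A g Z)"
    using assms by (rule gsections_cases)
  have "comb 1 (J (comb 1 (J X) (sqrt 2) Z)) (sqrt 2) (comb (sqrt 2) X (- 1) (J Z)) = X"
    "comb (sqrt 2) (comb 1 (J X) (sqrt 2) Z) (- 1) (J (comb (sqrt 2) X (- 1) (J Z))) = Z"
    using u by (auto simp: J_comb J_J vector_field_closure fun_eq_iff comb_apply fscale_apply algebra_simps)
  then show ?thesis using u by (simp add: F_Jg_flat vector_field_closure)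
qed

lemma F_Jg_rotation:
  assumes "u \<in> gsections A"
  shows "F_Jg A \<epsilon> J g (rotation u) = gscale (\<lambda>_. - 1) (rotation (F_Jg A \<epsilon> J g u))"
proof -
  obtain X Z where u: "X \<in> vector_fields A" "Z \<in> vector_fields A" "u = (X, flat A g Z)"
    using assms by (rule gsections_cases)
  have "comb 1 (J Z) (sqrt 2) (fscale (\<lambda>_. - 1) X) = fscale (\<lambda>_. - 1) (comb (sqrt 2) X (- 1) (J Z))"
    "comb (sqrt 2) Z (- 1) (J (fscale (\<lambda>_. - 1) X)) = comb 1 (J X) (sqrt 2) Z"
    "fscale (\<lambda>_. - 1) (fscale (\<lambda>_. - 1) (comb 1 (J X) (sqrt 2) Z)) = comb 1 (J X) (sqrt 2) Z"
    using u by (auto simp: J_fscale vector_field_closure fun_eq_iff comb_apply fscale_apply algebra_simps)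
  then show ?thesis using u by (simp add: F_Jg_flat rotation_flat gscale_flat vector_field_closure)
qed

lemma F_Jg_paracomplex: "gen_almost_paracomplex A (F_Jg A \<epsilon> J g)"
  unfolding gen_almost_paracomplex_def
  using F_Jg_linear F_Jg_involution eigenbundle_fibre_dim[OF F_Jg_linear F_Jg_rotation, of 1] by simp

section \<open>Compatibility with the natural metric and the twin metric\<close>

lemma natural_metric_F_Jg:
  assumes "X \<in> vector_fields A" "Y \<in> vector_fields A" "Z \<in> vector_fields A" "W \<in> vector_fields A"
  shows "natural_metric (F_Jg A \<epsilon> J g (X, flat A g Z)) (F_Jg A \<epsilon> J g (Y, flat A g W)) p =
    (2 - \<epsilon>) * natural_metric (X, flat A g Z) (Y, flat A g W) p +
    sqrt 2 / 2 * (1 - \<epsilon>) * (g X (J Y) p + \<epsilon> * g Z (J W) p)"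
proof -
  \<comment> \<open>These equations reduce the pairings in the expansion to g(X, W), g(Z, Y), g(X,
    JY) and g(Z, JW).\<close>
  have sym: "g W X p = g X W p" "g Y Z p = g Z Y p" "g Y (J X) p = - \<epsilon> * g X (J Y) p" "g (J W) Z p = g Z (J W) p"
    "g (J W) (J X) p = \<epsilon> * g X W p" "g (J Z) (J Y) p = \<epsilon> * g Z Y p" "g (J Z) W p = - \<epsilon> * g Z (J W) p"
    "g Y W p = g W Y p"
    using assms metric_sym metric_J_left metric_J_J J_vector_field by metis+
  have s2: "sqrt 2 * (sqrt 2 * t) = 2 * t" for t by (simp add: mult.assoc[symmetric])
  show ?thesis
    using \<epsilon> by (auto simp: F_Jg_flat natural_metric_flat assms vector_field_closure metric_comb sym s2 field_simps)
qed

lemma F_Jg_isometry: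
  assumes "\<epsilon> = 1" "u \<in> gsections A" "v \<in> gsections A"
  shows "natural_metric (F_Jg A \<epsilon> J g u) (F_Jg A \<epsilon> J g v) = natural_metric u v"
proof
  fix p
  obtain X Z where u: "X \<in> vector_fields A" "Z \<in> vector_fields A" "u = (X, flat A g Z)"
    using assms(2) by (rule gsections_cases)
  obtain Y W where v: "Y \<in> vector_fields A" "W \<in> vector_fields A" "v = (Y, flat A g W)"
    using assms(3) by (rule gsections_cases)
  show "natural_metric (F_Jg A \<epsilon> J g u) (F_Jg A \<epsilon> J g v) p = natural_metric u v p"
    using natural_metric_F_Jg[OF u(1) v(1) u(2) v(2), of p] by (simp add: u(3) v(3) assms(1))
qed

lemma F_Jg_compatible_iff: "compatible A (F_Jg A \<epsilon> J g) natural_metric \<longleftrightarrow> \<epsilon> = 1"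
proof
  assume "\<epsilon> = 1"
  from F_Jg_isometry[OF this] show "compatible A (F_Jg A \<epsilon> J g) natural_metric"
    unfolding compatible_def by (intro bexI[of _ 1]) simp_all
next
  assume "compatible A (F_Jg A \<epsilon> J g) natural_metric"
  then obtain \<delta> where \<delta>: "\<And>u v. u \<in> gsections A \<Longrightarrow> v \<in> gsections A \<Longrightarrow>
      natural_metric (F_Jg A \<epsilon> J g u) (F_Jg A \<epsilon> J g v) = (\<lambda>p. \<delta> * natural_metric u v p)"
    unfolding compatible_def by blast
  show "\<epsilon> = 1"
  proof (rule ccontr)
    assume "\<epsilon> \<noteq> 1"
    then have e: "\<epsilon> = - 1" using \<epsilon> by blast
    fix p
    \<comment> \<open>The sections X and Y have zero form part, so their natural pairing vanishes
      and the unknown \<delta> has no influence. The expansion leaves \<surd>2 g(X, JY) = 0.\<close>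
    have 0: "g X (J Y) p = 0" if "X \<in> vector_fields A" "Y \<in> vector_fields A" for X Y
    proof -
      note zero = vector_field_zero
      have "g 0 Z = 0" "g Z 0 = 0" if "Z \<in> vector_fields A" for Z
        using covector_zero[OF metric_linear_left[OF that]] covector_zero[OF metric_linear_right[OF that]] by auto
      then show ?thesis
        using fun_cong[OF \<delta>[OF gsections_flat[OF that(1) zero] gsections_flat[OF that(2) zero]], of p]
          natural_metric_F_Jg[OF that zero zero, of p] that zero e
        by (simp add: natural_metric_flat J_vector_field)
    qed
    obtain X Y where XY: "X \<in> vector_fields A" "Y \<in> vector_fields A" "g X Y p \<noteq> 0"
      using metric_nonzero by blast
    have "g X (J (J Y)) p = - g X Y p"
      using covector_fscale[OF metric_linear_right[OF XY(1)] smooth_const XY(2)] by (simp add: J_J XY(2))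
    then show False using 0[OF XY(1) J_vector_field[OF XY(2)]] XY(3) by simp
  qed
qed

text \<open>The diagonal entries J and -J contribute the pairing of JX + \<xi> with JY + \<eta>,
  because for \<epsilon> = 1 the endomorphism J is skew for g; the two entries \<surd>2 contribute
  the metric terms.\<close>

lemma F_Jg_twin_metric:
  assumes "\<epsilon> = 1" "X \<in> vector_fields A" "Y \<in> vector_fields A" "\<xi> \<in> one_forms A" "\<eta> \<in> one_forms A"
  shows "twin_metric (F_Jg A \<epsilon> J g) natural_metric (X, \<xi>) (Y, \<eta>) p =
    natural_metric (J X, \<xi>) (J Y, \<eta>) p + sqrt 2 / 2 * (g X Y p + g (sharp A g \<xi>) (sharp A g \<eta>) p)"
proof -
  define Z W where "Z = sharp A g \<xi>" and "W = sharp A g \<eta>"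
  have ZW: "Z \<in> vector_fields A" "W \<in> vector_fields A" and \<xi>: "\<xi> = flat A g Z" and \<eta>: "\<eta> = flat A g W"
    using assms(4,5) by (simp_all add: Z_def W_def sharp_vector_field flat_sharp)
  have "g (J Z) Y p = - g Z (J Y) p" "g W Z p = g Z W p"
    using metric_J_left[OF ZW(1) assms(3)] metric_sym[OF ZW] assms(1) by simp_all
  then show ?thesis
    unfolding twin_metric_def \<xi> \<eta> using assms(2,3) ZW
    by (simp add: F_Jg_flat natural_metric_flat vector_field_closure metric_comb sharp_flat field_simps)
qed

end

theorem proposition4p11:
  fixes A :: "('a::{t2_space, second_countable_topology}, 'e::euclidean_space) atlas"
    and \<alpha> \<epsilon> :: real
    and J :: "'a vfield \<Rightarrow> 'a vfield"
    and g :: "'a vfield \<Rightarrow> 'a vfield \<Rightarrow> 'a \<Rightarrow> real"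
  assumes "metric_manifold A \<alpha> \<epsilon> J g" and "\<alpha> = -1"
  shows "gen_almost_paracomplex A (F_Jg A \<epsilon> J g) \<and>
    (compatible A (F_Jg A \<epsilon> J g) natural_metric \<longleftrightarrow> \<epsilon> = 1) \<and>
    (\<epsilon> = 1 \<longleftrightarrow> almost_hermitian A J g \<or> indefinite_almost_hermitian A J g) \<and>
    (\<epsilon> = 1 \<longrightarrow>
      gen_pseudo_riemannian_almost_product A (F_Jg A \<epsilon> J g) natural_metric \<and>
      (\<forall>X\<in>vector_fields A. \<forall>Y\<in>vector_fields A. \<forall>\<xi>\<in>one_forms A. \<forall>\<eta>\<in>one_forms A. \<forall>p.
        twin_metric (F_Jg A \<epsilon> J g) natural_metric (X, \<xi>) (Y, \<eta>) p =
          natural_metric (J X, \<xi>) (J Y, \<eta>) p +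
          sqrt 2 / 2 * (g X Y p + g (sharp A g \<xi>) (sharp A g \<eta>) p)))"
proof -
  have mm: "metric_manifold A (- 1) \<epsilon> J g" using assms by simp
  interpret almost_complex_metric A g J \<epsilon>
  proof
    show "smooth_manifold A" "bundle_metric A fscale value_at (vector_fields A) g"
      "\<epsilon> = 1 \<or> \<epsilon> = - 1" "function_linear A fscale (vector_fields A) fscale (vector_fields A) J"
      using mm by (auto simp: metric_manifold_def riemannian_metric_def pseudo_riemannian_metric_def)
    show "J (J X) = fscale (\<lambda>_. - 1) X" if "X \<in> vector_fields A" for X
      using mm that by (simp add: metric_manifold_def)
    show "g (J X) (J Y) = (\<lambda>p. \<epsilon> * g X Y p)" if "X \<in> vector_fields A" "Y \<in> vector_fields A" for X Y
      using mm that by (simp add: metric_manifold_def)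
  qed
  \<comment> \<open>The Hermitian predicates do not mention \<epsilon>. It is recovered by comparing
    the two isometry laws on a pair of fields with nonzero product.\<close>
  have "\<epsilon> = 1" if "metric_manifold A (- 1) 1 J g"
  proof -
    fix p
    obtain X Y where XY: "X \<in> vector_fields A" "Y \<in> vector_fields A" "g X Y p \<noteq> 0"
      using metric_nonzero by blast
    have "g (J X) (J Y) = (\<lambda>p. 1 * g X Y p)"
      using that XY(1,2) unfolding metric_manifold_def by blast
    then have "1 * g X Y p = \<epsilon> * g X Y p"
      using metric_J_J[OF XY(1,2)] by metis
    then show ?thesis using XY(3) by simp
  qed
  then have herm: "\<epsilon> = 1 \<longleftrightarrow> almost_hermitian A J g \<or> indefinite_almost_hermitian A J g"
    using mm unfolding almost_hermitian_def indefinite_almost_hermitian_def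
    by (auto simp: metric_manifold_def)
  have "gen_pseudo_riemannian_almost_product A (F_Jg A \<epsilon> J g) natural_metric" if "\<epsilon> = 1"
    unfolding gen_pseudo_riemannian_almost_product_def
    using F_Jg_linear F_Jg_involution natural_metric_bundle_metric natural_metric_not_positive_definite
      F_Jg_isometry[OF that] by blast
  then show ?thesis
    using F_Jg_paracomplex F_Jg_compatible_iff herm F_Jg_twin_metric by blast
qed

end
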